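(* Let $A_1,\dots,A_n$ be wqos. Suppose there exist $i\in[1,n]$ such that $\mathbf{o}(A_i)$ is an infinite indecomposable ordinal, and $j_1\ne j_2\in[1,n]$ such that all exponents in the Cantor normal forms of $\mathbf{o}(A_{j_1})$ and $\mathbf{o}(A_{j_2})$ are infinite. Then $\mathbf{w}(A_1\times\dots\times A_n)=\mathbf{o}(A_1)\otimes\dots\otimes\mathbf{o}(A_n)$.
   Context: A wqo is a quasi-order with no infinite bad sequence (a sequence $x_0,x_1,\dots$ is bad if there are no $i<j$ with $x_i\le x_j$). $\mathbf{w}(A)$ (width) is the rank of the forest of nonempty finite sequences of pairwise incomparable elements ordered by initial segment; $\mathbf{o}(A)$ (maximal order type) is the rank of the forest of nonempty finite bad sequences ordered by initial segment (equivalently the maximal order type of a linear extension). An ordinal is infinite indecomposable if it equals $\omega^\beta$ with $\beta\ge1$. Products have the componentwise order; $\otimes$ is the natural (Hessenberg) product. *)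

theory Defs
  imports Main "HOL-Library.Sublist" "HOL-Library.FuncSet"
begin

text \<open>Ordinals of cardinality at most |'x|: well-orders on subsets of 'x modulo isomorphism.\<close>

lemma Well_order_empty_rel: "Well_order ({} :: 'x rel)"
  by (simp add: well_order_on_def linear_order_on_def partial_order_on_def preorder_on_def
      refl_on_def trans_on_def antisym_def total_on_def Field_def wf_on_def)

lemma ordIso_part_equivp: "part_equivp (\<lambda>(r::'x rel) s. (r, s) \<in> ordIso)"
proof (rule part_equivpI)
  show "\<exists>x::'x rel. (x, x) \<in> ordIso"
    using ordIso_reflexive[OF Well_order_empty_rel] by blast
  show "symp (\<lambda>(r::'x rel) s. (r, s) \<in> ordIso)"
    by (auto intro: sympI ordIso_symmetric)
  show "transp (\<lambda>(r::'x rel) s. (r, s) \<in> ordIso)"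
    by (auto intro: transpI ordIso_transitive)
qed

quotient_type 'x ordinal = "'x rel" / partial: "\<lambda>r s. (r, s) \<in> ordIso"
  by (rule ordIso_part_equivp)

lift_definition ord_le :: "'x ordinal \<Rightarrow> 'x ordinal \<Rightarrow> bool"
  is "\<lambda>r s. (r, s) \<in> ordLeq"
  by (meson ordIso_iff_ordLeq ordLeq_transitive)

lemma ordIso_refl_WO: "(r, r) \<in> ordIso \<Longrightarrow> Well_order r"
  by (simp add: ordIso_def)

lemma rep_ordinal_WO: "Well_order (rep_ordinal a)"
  using Quotient3_rep_reflp[OF Quotient3_ordinal] ordIso_refl_WO by blast

lemma ord_le_rep: "ord_le a b \<longleftrightarrow> (rep_ordinal a, rep_ordinal b) \<in> ordLeq"
  by (simp add: ord_le_def)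

lemma ord_le_refl: "ord_le a a"
  by (simp add: ord_le_rep ordLeq_reflexive rep_ordinal_WO)

lemma ord_le_trans: "ord_le a b \<Longrightarrow> ord_le b c \<Longrightarrow> ord_le a c"
  unfolding ord_le_rep using ordLeq_transitive by blast

lemma ord_le_total: "ord_le a b \<or> ord_le b a"
  unfolding ord_le_rep using ordLeq_total rep_ordinal_WO by blast

lemma ord_le_antisym: "ord_le a b \<Longrightarrow> ord_le b a \<Longrightarrow> a = b"
proof -
  assume "ord_le a b" "ord_le b a"
  then have "(rep_ordinal a, rep_ordinal b) \<in> ordIso"
    unfolding ord_le_rep using ordIso_iff_ordLeq by blast
  then show "a = b"
    using Quotient3_rel_rep[OF Quotient3_ordinal] by blast
qed


instantiation ordinal :: (type) linorder
begin
definition less_eq_ordinal :: "'x ordinal \<Rightarrow> 'x ordinal \<Rightarrow> bool" where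
  "less_eq_ordinal = ord_le"
definition less_ordinal :: "'x ordinal \<Rightarrow> 'x ordinal \<Rightarrow> bool" where
  "less_ordinal a b = (ord_le a b \<and> \<not> ord_le b a)"
instance
proof
  fix x y z :: "'x ordinal"
  show "(x < y) = (x \<le> y \<and> \<not> y \<le> x)"
    by (simp add: less_eq_ordinal_def less_ordinal_def)
  show "x \<le> x" by (simp add: less_eq_ordinal_def ord_le_refl)
  show "x \<le> y \<Longrightarrow> y \<le> z \<Longrightarrow> x \<le> z" unfolding less_eq_ordinal_def
    by (rule ord_le_trans)
  show "x \<le> y \<Longrightarrow> y \<le> x \<Longrightarrow> x = y" unfolding less_eq_ordinal_def
    by (rule ord_le_antisym)
  show "x \<le> y \<or> y \<le> x" unfolding less_eq_ordinal_def
    by (rule ord_le_total)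
qed
end

lemma wf_less_ordinal: "wf {(a, b :: 'x ordinal). a < b}"
proof -
  have "{(a, b :: 'x ordinal). a < b} \<subseteq> inv_image ordLess rep_ordinal"
  proof (clarsimp simp: less_ordinal_def)
    fix a b :: "'x ordinal"
    assume "ord_le a b" "\<not> ord_le b a"
    then show "(rep_ordinal a, rep_ordinal b) \<in> ordLess"
      unfolding ord_le_rep using not_ordLeq_iff_ordLess rep_ordinal_WO by blast
  qed
  then show ?thesis using wf_subset wf_inv_image wf_ordLess by blast
qed

instance ordinal :: (type) wellorder
proof
  fix P :: "'x ordinal \<Rightarrow> bool" and a :: "'x ordinal"
  assume "\<And>x. (\<And>y. y < x \<Longrightarrow> P y) \<Longrightarrow> P x"
  then show "P a" using wf_induct[OF wf_less_ordinal, of P] by blast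
qed

definition ozero :: "'x ordinal" where
  "ozero = (LEAST a. True)"

definition osup :: "'x ordinal set \<Rightarrow> 'x ordinal" where
  "osup S = (LEAST a. \<forall>s\<in>S. s \<le> a)"

definition osucc :: "'x ordinal \<Rightarrow> 'x ordinal" where
  "osucc a = (LEAST b. a < b)"

definition oone :: "'x ordinal" where
  "oone = osucc ozero"

definition oomega :: "'x ordinal" where
  "oomega = (LEAST a. ozero < a \<and> (\<forall>b<a. osucc b < a))"

definition oadd :: "'x ordinal \<Rightarrow> 'x ordinal \<Rightarrow> 'x ordinal" where
  "oadd a = wfrec {(x, y). x < y} (\<lambda>f b. osup ({a} \<union> {osucc (f c) | c. c < b}))"

definition omult :: "'x ordinal \<Rightarrow> 'x ordinal \<Rightarrow> 'x ordinal" where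
  "omult a = wfrec {(x, y). x < y} (\<lambda>f b. osup ({ozero} \<union> {oadd (f c) a | c. c < b}))"

definition oexp_omega :: "'x ordinal \<Rightarrow> 'x ordinal" where
  "oexp_omega = wfrec {(x, y). x < y} (\<lambda>f b. osup ({oone} \<union> {omult (f c) oomega | c. c < b}))"

definition cnf_eval :: "'x ordinal list \<Rightarrow> 'x ordinal" where
  "cnf_eval bs = foldr (\<lambda>b acc. oadd (oexp_omega b) acc) bs ozero"

definition cnf :: "'x ordinal \<Rightarrow> 'x ordinal list" where
  "cnf a = (THE bs. sorted_wrt (\<ge>) bs \<and> cnf_eval bs = a)"

definition natural_sum :: "'x ordinal \<Rightarrow> 'x ordinal \<Rightarrow> 'x ordinal" where
  "natural_sum a b = cnf_eval (rev (sort (cnf a @ cnf b)))"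

definition natural_prod :: "'x ordinal \<Rightarrow> 'x ordinal \<Rightarrow> 'x ordinal" where
  "natural_prod a b = cnf_eval (rev (sort [natural_sum x y. x \<leftarrow> cnf a, y \<leftarrow> cnf b]))"

definition infinite_indecomposable :: "'x ordinal \<Rightarrow> bool" where
  "infinite_indecomposable a \<longleftrightarrow> (\<exists>b. oone \<le> b \<and> a = oexp_omega b)"

definition all_cnf_exponents_infinite :: "'x ordinal \<Rightarrow> bool" where
  "all_cnf_exponents_infinite a \<longleftrightarrow> (\<forall>e\<in>set (cnf a). oomega \<le> e)"

definition node_rank :: "'b list set \<Rightarrow> 'b list \<Rightarrow> 'x ordinal" where
  "node_rank F = wfrec {(t, s). t \<in> F \<and> s \<in> F \<and> strict_prefix s t}
     (\<lambda>r s. osup {osucc (r t) | t. t \<in> F \<and> strict_prefix s t})"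

definition forest_rank :: "'b list set \<Rightarrow> 'x ordinal" where
  "forest_rank F = osup {osucc (node_rank F s) | s. s \<in> F}"

definition qo_on :: "'b set \<Rightarrow> ('b \<Rightarrow> 'b \<Rightarrow> bool) \<Rightarrow> bool" where
  "qo_on A le \<longleftrightarrow> (\<forall>x\<in>A. le x x) \<and> (\<forall>x\<in>A. \<forall>y\<in>A. \<forall>z\<in>A. le x y \<longrightarrow> le y z \<longrightarrow> le x z)"

definition wqo_on :: "'b set \<Rightarrow> ('b \<Rightarrow> 'b \<Rightarrow> bool) \<Rightarrow> bool" where
  "wqo_on A le \<longleftrightarrow> qo_on A le \<and>
     (\<forall>f::nat \<Rightarrow> 'b. (\<forall>i. f i \<in> A) \<longrightarrow> (\<exists>i j. i < j \<and> le (f i) (f j)))"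

definition bad_seqs :: "'b set \<Rightarrow> ('b \<Rightarrow> 'b \<Rightarrow> bool) \<Rightarrow> 'b list set" where
  "bad_seqs A le = {xs. xs \<noteq> [] \<and> set xs \<subseteq> A \<and>
     (\<forall>i j. i < j \<and> j < length xs \<longrightarrow> \<not> le (xs ! i) (xs ! j))}"

definition antichain_seqs :: "'b set \<Rightarrow> ('b \<Rightarrow> 'b \<Rightarrow> bool) \<Rightarrow> 'b list set" where
  "antichain_seqs A le = {xs. xs \<noteq> [] \<and> set xs \<subseteq> A \<and>
     (\<forall>i j. i < length xs \<and> j < length xs \<and> i \<noteq> j \<longrightarrow> \<not> le (xs ! i) (xs ! j))}"

definition wqo_width :: "'b set \<Rightarrow> ('b \<Rightarrow> 'b \<Rightarrow> bool) \<Rightarrow> 'x ordinal" where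
  "wqo_width A le = forest_rank (antichain_seqs A le)"

definition wqo_mot :: "'b set \<Rightarrow> ('b \<Rightarrow> 'b \<Rightarrow> bool) \<Rightarrow> 'x ordinal" where
  "wqo_mot A le = forest_rank (bad_seqs A le)"

definition prod_le :: "nat set \<Rightarrow> (nat \<Rightarrow> 'a \<Rightarrow> 'a \<Rightarrow> bool) \<Rightarrow> (nat \<Rightarrow> 'a) \<Rightarrow> (nat \<Rightarrow> 'a) \<Rightarrow> bool" where
  "prod_le I le f g \<longleftrightarrow> (\<forall>i\<in>I. le i (f i) (g i))"

text \<open>Ordinal type large enough for all ordinals occurring in the theorem.\<close>
type_synonym 'a big_ordinal = "((nat \<Rightarrow> 'a) list \<times> nat) ordinal"

end

theory Submission
  imports
    Defs
    "HOL-Library.Infinite_Typeclass"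
    "HOL-Library.Multiset_Order"
    "HOL-Library.Product_Lexorder"
begin

text \<open>
  Write \<open>o\<close> and \<open>w\<close> for maximal order type and width. If \<open>o(A) = \<omega>^e\<^sub>1 + \<dots> + \<omega>^e\<^sub>m\<close> in
  Cantor normal form, then \<open>A\<close> splits into pieces \<open>B\<^sub>1, \<dots>, B\<^sub>m\<close> with \<open>o(B\<^sub>p) = \<omega>^e\<^sub>p\<close> such that no
  element of a piece lies below an element of an earlier piece: some downward closed \<open>D\<close> in \<open>A\<close> has
  type \<open>\<omega>^e\<^sub>1 + \<dots> + \<omega>^e\<^sub>m\<^sub>-\<^sub>1\<close>, and \<open>o(D) + o(A - D) \<le> o(A) \<le> o(D) \<oplus> o(A - D)\<close> determines \<open>o(A - D)\<close>.

  Upper bound: \<open>w \<le> o\<close>, and for pieces of types \<open>\<omega>^b\<^sub>k\<close> the elements of the product not above a given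
  one lie in finitely many products of pieces in which one exponent has dropped, so by induction the
  product has type at most \<open>\<omega>^(b\<^sub>1 \<oplus> \<dots> \<oplus> b\<^sub>n)\<close>. Subadditivity and distributivity give the general case.

  Lower bound: play the products of pieces one after another, in increasing order of exponents. In the
  coordinate with indecomposable infinite type one can always move up to elements that are not below
  any of the finitely many elements played so far, while another coordinate moves to an earlier piece,
  so everything stays incomparable. The same trick inside a single product of pieces shows by induction
  on the exponents that its width is at least \<open>\<omega>^(c\<^sub>1 \<oplus> \<dots> \<oplus> c\<^sub>n)\<close> when two of the exponents are
  \<open>1 + c\<^sub>k\<close> and the others are \<open>c\<^sub>k\<close>; and \<open>1 + c = c\<close> for infinite \<open>c\<close>.
\<close>

section \<open>Ordinals\<close>

unbundle cardinal_syntax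

lemma less_ordinal_iff_ordLess: "a < b \<longleftrightarrow> rep_ordinal a <o rep_ordinal b"
  unfolding less_ordinal_def ord_le_rep
  using not_ordLeq_iff_ordLess rep_ordinal_WO ordLess_imp_ordLeq by blast

lemma rep_ordinal_ordIso_eq: "rep_ordinal a =o rep_ordinal b \<Longrightarrow> a = b"
  using Quotient3_rel_rep[OF Quotient3_ordinal] by blast

lemma rep_abs_ordinal: "Well_order r \<Longrightarrow> rep_ordinal (abs_ordinal r) =o r"
  using Quotient3_rep_abs[OF Quotient3_ordinal] ordIso_reflexive by blast

lemma Well_order_less_eq: "Well_order {(x, y :: 'a::wellorder). x \<le> y}"
proof -
  have "{(x, y :: 'a). x \<le> y} - Id = {(x, y). x < y}" by auto
  then have "wf ({(x, y :: 'a). x \<le> y} - Id)" by (simp add: wf)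
  moreover have "Field {(x, y :: 'a). x \<le> y} = UNIV" by (auto simp: Field_def)
  ultimately show ?thesis
    by (auto simp: order_on_defs refl_on_def total_on_def trans_def antisym_def)
qed

lemma underS_less_eq: "underS {(x, y :: 'a::order). x \<le> y} a = {..<a}"
  by (auto simp: underS_def)

lemma abs_ordinal_underS_less:
  assumes r: "Well_order r" and xy: "(x, y) \<in> r" "x \<noteq> y"
  shows "abs_ordinal (Restr r (underS r x)) < abs_ordinal (Restr r (underS r y))"
proof -
  have ofilter: "wo_rel.ofilter r (underS r z)" for z
    using r by (simp add: wo_rel.underS_ofilter wo_rel_def)
  have "trans r" "antisym r"
    using r by (auto simp: order_on_defs)
  then have "underS r x \<subset> underS r y"
    using xy by (auto simp: underS_def dest: transD antisymD)
  then have "Restr r (underS r x) <o Restr r (underS r y)"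
    using ofilter_subset_ordLess[OF r ofilter ofilter] by blast
  moreover have "rep_ordinal (abs_ordinal (Restr r X)) =o Restr r X" for X
    by (rule rep_abs_ordinal[OF Well_order_Restr[OF r]])
  ultimately show ?thesis
    unfolding less_ordinal_iff_ordLess
    using ordIso_ordLess_trans ordLess_ordIso_trans ordIso_symmetric by blast
qed

lemma rep_ordinal_ordIso_lessThan: "rep_ordinal a =o Restr {(b, c). b \<le> c} {..<a}"
proof -
  let ?r = "rep_ordinal a" and ?s = "Restr {(b, c). b \<le> c} {..<a}"
  let ?f = "\<lambda>x. abs_ordinal (Restr ?r (underS ?r x))"
  note r = rep_ordinal_WO[of a]
  have rep: "rep_ordinal (?f x) =o Restr ?r (underS ?r x)" for x
    by (rule rep_abs_ordinal[OF Well_order_Restr[OF r]])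
  have mono: "?f x < ?f y" if "(x, y) \<in> ?r" "x \<noteq> y" for x y
    using r that by (rule abs_ordinal_underS_less)
  have total: "(x, y) \<in> ?r \<or> (y, x) \<in> ?r" if "x \<in> Field ?r" "y \<in> Field ?r" for x y
    using r that by (metis wo_rel.TOTALS wo_rel_def)
  have less: "?f x < a" if "x \<in> Field ?r" for x
    using underS_Restr_ordLess[OF r] that rep ordIso_ordLess_trans
    unfolding less_ordinal_iff_ordLess by blast
  moreover have "\<exists>x\<in>Field ?r. b = ?f x" if b: "b < a" for b
  proof -
    obtain x where "x \<in> Field ?r" "rep_ordinal b =o Restr ?r (underS ?r x)"
      using b ordLess_iff_ordIso_Restr[OF r rep_ordinal_WO] unfolding less_ordinal_iff_ordLess by blast
    then show ?thesis
      using rep_ordinal_ordIso_eq rep ordIso_symmetric ordIso_transitive by blast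
  qed
  ultimately have "?f ` Field ?r = {..<a}" by blast
  moreover have "inj_on ?f (Field ?r)"
    by (rule inj_onI) (metis mono total order_less_irrefl)
  moreover have "Field ?s = {..<a}" by (auto simp: Field_def)
  ultimately have "bij_betw ?f (Field ?r) (Field ?s)" by (simp add: bij_betw_def)
  moreover have "compat ?r ?s ?f"
    unfolding compat_def using mono less by (force intro: FieldI1 FieldI2)
  moreover have s: "Well_order ?s" by (rule Well_order_Restr[OF Well_order_less_eq])
  ultimately have "iso ?r ?s ?f" using iso_iff3[OF r] by blast
  then show ?thesis using r s by (auto simp: ordIso_def)
qed

definition small :: "'x ordinal set \<Rightarrow> bool" where
  "small S \<longleftrightarrow> |S| \<le>o |UNIV :: 'x set|"

lemma small_lessThan: "small {..<a :: 'x ordinal}"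
proof -
  obtain f where "iso (rep_ordinal a) (Restr {(b, c). b \<le> c} {..<a}) f"
    using rep_ordinal_ordIso_lessThan by (auto simp: ordIso_def)
  moreover have "Field (Restr {(b, c). b \<le> c} {..<a}) = {..<a}" by (auto simp: Field_def)
  ultimately have "bij_betw f (Field (rep_ordinal a)) {..<a}" by (simp add: iso_iff2)
  then have "|{..<a}| \<le>o |Field (rep_ordinal a)|"
    using card_of_ordIsoI ordIso_symmetric ordIso_imp_ordLeq by blast
  then show ?thesis
    unfolding small_def using card_of_mono1[OF subset_UNIV] ordLeq_transitive by blast
qed

text \<open>Burali-Forti: otherwise the order type of all ordinals over \<^typ>\<open>'x\<close> is itself such an ordinal,
  and it is isomorphic to its own initial segment.\<close>
lemma not_small_UNIV: "\<not> small (UNIV :: 'x ordinal set)"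
proof
  let ?le = "{(a, b :: 'x ordinal). a \<le> b}"
  assume "small (UNIV :: 'x ordinal set)"
  then obtain f :: "'x ordinal \<Rightarrow> 'x" where f: "inj f"
    unfolding small_def using card_of_ordLeq[of "UNIV :: 'x ordinal set" "UNIV :: 'x set"] by blast
  then have inj: "inj_on f (Field ?le)" by (rule inj_on_subset) simp
  let ?t = "abs_ordinal (dir_image ?le f)"
  have "rep_ordinal ?t =o dir_image ?le f"
    by (rule rep_abs_ordinal[OF Well_order_dir_image[OF Well_order_less_eq inj]])
  then have "?le =o rep_ordinal ?t"
    using dir_image_ordIso[OF Well_order_less_eq inj] ordIso_symmetric ordIso_transitive by blast
  also have "rep_ordinal ?t =o Restr ?le {..<?t}" by (rule rep_ordinal_ordIso_lessThan)
  also have "Restr ?le {..<?t} <o ?le"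
    by (rule underS_Restr_ordLess[OF Well_order_less_eq, of ?t, unfolded underS_less_eq])
      (use order.refl in \<open>blast intro: FieldI1\<close>)
  finally show False by (rule ordLess_irreflexive[THEN notE, rotated])
qed

lemma small_image: "small S \<Longrightarrow> small (f ` S)" for f :: "'x ordinal \<Rightarrow> 'x ordinal"
  unfolding small_def using card_of_image ordLeq_transitive by blast

lemma small_Un: "small S \<Longrightarrow> small T \<Longrightarrow> small (S \<union> T :: 'x::infinite ordinal set)"
  unfolding small_def
  using card_of_Un_ordLeq_infinite_Field[of "|UNIV :: 'x set|" S T] infinite_UNIV[where 'a='x]
    card_of_card_order_on[of "UNIV :: 'x set"]
  by (simp add: Field_card_of)

lemma small_range_nat: "small (range f)" for f :: "nat \<Rightarrow> 'x::infinite ordinal"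
proof -
  have "|range f| \<le>o |UNIV :: nat set|" by (rule card_of_image)
  also have "|UNIV :: nat set| \<le>o |UNIV :: 'x set|"
    using infinite_UNIV[where 'a='x] by (simp add: infinite_iff_card_of_nat)
  finally show ?thesis by (simp add: small_def)
qed

lemma small_singleton: "small {a :: 'x::infinite ordinal}"
  using small_range_nat[of "\<lambda>_. a"] by simp

lemma small_bounded:
  fixes S :: "'x::infinite ordinal set"
  assumes "small S"
  obtains b where "\<And>s. s \<in> S \<Longrightarrow> s < b"
proof -
  have "|\<Union>s\<in>S. {..<s} \<union> {s}| \<le>o |UNIV :: 'x set|"
  proof (rule card_of_UNION_ordLeq_infinite)
    show "\<forall>s\<in>S. |{..<s} \<union> {s}| \<le>o |UNIV :: 'x set|"
      using small_Un[OF small_lessThan small_singleton] unfolding small_def by blast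
  qed (use assms infinite_UNIV in \<open>auto simp: small_def\<close>)
  then have "(\<Union>s\<in>S. {..<s} \<union> {s}) \<noteq> UNIV" using not_small_UNIV unfolding small_def by metis
  then obtain b where "b \<notin> (\<Union>s\<in>S. {..<s} \<union> {s})" by blast
  then show thesis using that[of b] by fastforce
qed

lemma osup_le_iff:
  fixes S :: "'x::infinite ordinal set"
  assumes "small S"
  shows "osup S \<le> a \<longleftrightarrow> (\<forall>s\<in>S. s \<le> a)"
proof -
  obtain b where "\<And>s. s \<in> S \<Longrightarrow> s < b" using assms by (rule small_bounded) blast
  then have "\<forall>s\<in>S. s \<le> b" by (simp add: less_imp_le)
  then have "\<forall>s\<in>S. s \<le> osup S" unfolding osup_def by (rule LeastI)
  then show ?thesis
    unfolding osup_def by (auto intro: Least_le order_trans)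
qed

lemma less_osup_iff: "small S \<Longrightarrow> a < osup S \<longleftrightarrow> (\<exists>s\<in>S. a < (s :: 'x::infinite ordinal))"
  by (simp add: osup_le_iff flip: not_le)

lemma osucc_le_iff [simp]: "osucc (a :: 'x::infinite ordinal) \<le> b \<longleftrightarrow> a < b"
proof -
  obtain c where "a < c" by (rule small_bounded[OF small_singleton[of a]]) blast
  then have "a < osucc a" unfolding osucc_def by (rule LeastI)
  then show ?thesis unfolding osucc_def by (auto intro: Least_le)
qed

lemma less_osucc_iff [simp]: "b < osucc (a :: 'x::infinite ordinal) \<longleftrightarrow> b \<le> a"
  by (meson osucc_le_iff not_le)

instantiation ordinal :: (type) "{zero, one}"
begin
definition zero_ordinal :: "'a ordinal" where "0 = ozero"
definition one_ordinal :: "'a ordinal" where "1 = oone"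
instance ..
end

lemma ordinal_zero_le [simp]: "0 \<le> (a :: 'x ordinal)"
  by (simp add: zero_ordinal_def ozero_def Least_le)

lemma ordinal_not_less_zero [simp]: "\<not> (a :: 'x ordinal) < 0"
  by (simp add: not_less)

lemma ordinal_le_zero_iff [simp]: "a \<le> 0 \<longleftrightarrow> a = (0 :: 'x ordinal)"
  by (simp add: order.antisym)

lemma ordinal_zero_less_iff: "0 < a \<longleftrightarrow> a \<noteq> (0 :: 'x ordinal)"
  by (auto simp: order_less_le)

lemma one_ordinal_eq_osucc: "1 = osucc (0 :: 'x ordinal)"
  by (simp add: one_ordinal_def oone_def zero_ordinal_def)

lemma ordinal_less_one_iff [simp]: "a < 1 \<longleftrightarrow> a = (0 :: 'x::infinite ordinal)"
  by (simp add: one_ordinal_eq_osucc)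

lemma ordinal_one_le_iff: "1 \<le> a \<longleftrightarrow> a \<noteq> (0 :: 'x::infinite ordinal)"
  by (simp add: one_ordinal_eq_osucc ordinal_zero_less_iff)

section \<open>Ordinal arithmetic\<close>

lemma eqI_same_less: "(\<And>d. d < a \<longleftrightarrow> d < b) \<Longrightarrow> a = b" for a b :: "'a::linorder"
  by (metis linorder_less_linear order_less_irrefl)

lemma le_strict_mono_wellorder:
  fixes f :: "'a::wellorder \<Rightarrow> 'a"
  assumes "strict_mono f"
  shows "x \<le> f x"
proof (induction x rule: less_induct)
  case (less x)
  then show ?case using assms by (metis leD leI strict_mono_less)
qed

definition transfinite_iter :: "'x ordinal \<Rightarrow> ('x ordinal \<Rightarrow> 'x ordinal) \<Rightarrow> 'x ordinal \<Rightarrow> 'x ordinal" where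
  "transfinite_iter z h = wfrec {(x, y). x < y} (\<lambda>f b. osup ({z} \<union> {h (f c) | c. c < b}))"

lemma less_transfinite_iter_iff:
  fixes z :: "'x::infinite ordinal"
  shows "d < transfinite_iter z h b \<longleftrightarrow> d < z \<or> (\<exists>c<b. d < h (transfinite_iter z h c))"
proof -
  let ?S = "(\<lambda>c. h (transfinite_iter z h c)) ` {..<b}"
  have "transfinite_iter z h b = osup ({z} \<union> {h (transfinite_iter z h c) | c. c < b})"
    unfolding transfinite_iter_def
    by (subst wfrec_fixpoint[OF wf_less_ordinal])
      (auto simp: adm_wf_def intro!: arg_cong[where f = osup] arg_cong[where f = "insert z"], metis+)
  also have "{h (transfinite_iter z h c) | c. c < b} = ?S" by auto
  finally have "transfinite_iter z h b = osup ({z} \<union> ?S)" .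
  moreover have "small ({z} \<union> ?S)"
    by (intro small_Un small_singleton small_image small_lessThan)
  ultimately show ?thesis by (auto simp: less_osup_iff)
qed

lemma less_oadd_iff: "d < oadd a b \<longleftrightarrow> d < a \<or> (\<exists>c<b. d \<le> oadd a (c :: 'x::infinite ordinal))"
  using less_transfinite_iter_iff[of d a osucc b] by (simp add: transfinite_iter_def oadd_def)

lemma less_omult_iff: "d < omult a b \<longleftrightarrow> (\<exists>c<b. d < oadd (omult a c) (a :: 'x::infinite ordinal))"
  using less_transfinite_iter_iff[of d 0 "\<lambda>x. oadd x a" b]
  by (simp add: transfinite_iter_def omult_def flip: zero_ordinal_def)

lemma less_oexp_omega_iff_omult:
  "d < oexp_omega b \<longleftrightarrow> d = 0 \<or> (\<exists>c<b. d < omult (oexp_omega c) (oomega :: 'x::infinite ordinal))"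
  using less_transfinite_iter_iff[of d 1 "\<lambda>x. omult x oomega" b]
  by (simp add: transfinite_iter_def oexp_omega_def flip: one_ordinal_def)

lemma strict_mono_oadd: "strict_mono (oadd (a :: 'x::infinite ordinal))"
  by (rule strict_monoI) (use less_oadd_iff in blast)

lemma oadd_less_cancel_left [simp]: "oadd a b < oadd a c \<longleftrightarrow> b < (c :: 'x::infinite ordinal)"
  by (rule strict_mono_less[OF strict_mono_oadd])

lemma oadd_le_cancel_left [simp]: "oadd a b \<le> oadd a c \<longleftrightarrow> b \<le> (c :: 'x::infinite ordinal)"
  by (rule strict_mono_less_eq[OF strict_mono_oadd])

lemma le_oadd_left: "a \<le> oadd a (b :: 'x::infinite ordinal)"
  using less_oadd_iff by (metis not_le_imp_less order_less_irrefl)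

lemma le_oadd_right: "b \<le> oadd a (b :: 'x::infinite ordinal)"
  by (rule le_strict_mono_wellorder[OF strict_mono_oadd])

lemma oadd_0 [simp]: "oadd a 0 = (a :: 'x::infinite ordinal)"
  by (rule eqI_same_less) (simp add: less_oadd_iff)

lemma oadd_osucc: "oadd a (osucc b) = osucc (oadd a (b :: 'x::infinite ordinal))"
proof (rule order.antisym)
  show "oadd a (osucc b) \<le> osucc (oadd a b)"
  proof (rule leI, rule notI)
    assume "osucc (oadd a b) < oadd a (osucc b)"
    then have "osucc (oadd a b) < a \<or> (\<exists>c\<le>b. osucc (oadd a b) \<le> oadd a c)"
      by (simp add: less_oadd_iff[of "osucc _"])
    then show False
      using le_oadd_left[of a b] by (auto simp: not_less[symmetric] dest: order_less_imp_le)
  qed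
qed simp

lemma oadd_0_left [simp]: "oadd 0 b = (b :: 'x::infinite ordinal)"
proof (induction b rule: less_induct)
  case (less b)
  then have "d < oadd 0 b \<longleftrightarrow> d < b" for d by (auto simp: less_oadd_iff[of d 0 b])
  then show ?case by (rule eqI_same_less)
qed

lemma oadd_mono_left: "a \<le> a' \<Longrightarrow> oadd a b \<le> oadd a' (b :: 'x::infinite ordinal)"
proof (induction b rule: less_induct)
  case (less b)
  have "d < oadd a' b" if "d < oadd a b" for d
    using that less unfolding less_oadd_iff[of d] by (metis order_less_le_trans order_trans)
  then show ?case using linorder_not_less by blast
qed

lemma oadd_mono: "a \<le> a' \<Longrightarrow> b \<le> b' \<Longrightarrow> oadd a b \<le> oadd a' (b' :: 'x::infinite ordinal)"
  using oadd_mono_left oadd_le_cancel_left order_trans by blast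

lemma oadd_assoc: "oadd (oadd a b) c = oadd a (oadd b (c :: 'x::infinite ordinal))"
proof (induction c rule: less_induct)
  case (less c)
  have absorb: "(\<exists>e\<le>x. d \<le> oadd a e) \<longleftrightarrow> d \<le> oadd a x" for d x
    by (meson oadd_le_cancel_left order_refl order_trans)
  have "d < oadd (oadd a b) c \<longleftrightarrow> d < oadd a (oadd b c)" for d
  proof -
    have "d < oadd (oadd a b) c \<longleftrightarrow>
        d < a \<or> (\<exists>e<b. d \<le> oadd a e) \<or> (\<exists>u<c. \<exists>e\<le>(oadd b u). d \<le> oadd a e)"
      using less by (auto simp: absorb less_oadd_iff[of d "oadd a b" c] less_oadd_iff[of d a b])
    also have "\<dots> \<longleftrightarrow> d < oadd a (oadd b c)"
      by (auto simp: less_oadd_iff[of d a "oadd b c"] less_oadd_iff[of _ b c])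
    finally show ?thesis .
  qed
  then show ?case by (rule eqI_same_less)
qed

lemma le_imp_oadd_eq:
  assumes "a \<le> (c :: 'x::infinite ordinal)"
  obtains d where "c = oadd a d"
proof -
  let ?d = "LEAST d. c \<le> oadd a d"
  have upper: "c \<le> oadd a ?d" using le_oadd_right by (rule LeastI)
  have "\<not> c < oadd a ?d"
  proof
    assume "c < oadd a ?d"
    then obtain d' where "d' < ?d" "c \<le> oadd a d'"
      using assms by (auto simp: less_oadd_iff not_less[symmetric])
    then show False using not_less_Least by blast
  qed
  then show thesis using upper that[of ?d] by simp
qed

subsection \<open>Finite ordinals and \<open>\<omega>\<close>\<close>

lemma le_finite_ordinalE:
  assumes "b \<le> (osucc ^^ n) (0 :: 'x::infinite ordinal)"
  obtains m where "b = (osucc ^^ m) 0"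
proof -
  from assms have "\<exists>m. b = (osucc ^^ m) 0"
  proof (induction n)
    case 0
    then show ?case by (auto intro: exI[of _ 0])
  next
    case (Suc n)
    then consider "b = (osucc ^^ Suc n) 0" | "b \<le> (osucc ^^ n) 0"
      by (auto simp: order_le_less)
    then show ?case using Suc.IH by cases blast+
  qed
  then show thesis using that by blast
qed

lemma less_oomega_iff: "b < oomega \<longleftrightarrow> (\<exists>n. b = (osucc ^^ n) (0 :: 'x::infinite ordinal))"
proof -
  let ?fin = "\<lambda>n. (osucc ^^ n) (0 :: 'x ordinal)"
  define w where "w = (LEAST w. \<forall>n. ?fin n < w)"
  obtain u where "\<And>s. s \<in> range ?fin \<Longrightarrow> s < u" by (rule small_bounded[OF small_range_nat]) blast
  then have "\<forall>n. ?fin n < u" by blast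
  then have "\<forall>n. ?fin n < w" unfolding w_def by (rule LeastI)
  then have fin: "?fin n < w" for n by blast
  have less_w: "b < w \<longleftrightarrow> (\<exists>n. b = ?fin n)" for b
  proof
    assume "b < w"
    then have "\<not> (\<forall>n. ?fin n < b)" unfolding w_def by (rule not_less_Least)
    then obtain n where "b \<le> ?fin n" by (auto simp: not_less)
    then show "\<exists>n. b = ?fin n" by (rule le_finite_ordinalE) blast
  qed (use fin in blast)
  have "oomega = w"
    unfolding oomega_def
  proof (rule Least_equality)
    have "osucc b < w" if "b < w" for b
      using that fin[of "Suc _"] by (auto simp: less_w simp del: osucc_le_iff)
    then show "ozero < w \<and> (\<forall>b<w. osucc b < w)"
      using fin[of 0] by (simp add: zero_ordinal_def)
  next
    fix a :: "'x ordinal"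
    assume limit: "ozero < a \<and> (\<forall>b<a. osucc b < a)"
    have "?fin n < a" for n
      using limit by (induction n) (simp_all add: zero_ordinal_def)
    then show "w \<le> a" unfolding w_def by (simp add: Least_le)
  qed
  then show ?thesis using less_w by simp
qed

lemma one_oadd_finite: "oadd 1 ((osucc ^^ n) 0) = (osucc ^^ Suc n) (0 :: 'x::infinite ordinal)"
  by (induction n) (simp_all add: one_ordinal_eq_osucc oadd_osucc)

lemma one_oadd_infinite:
  assumes "oomega \<le> (c :: 'x::infinite ordinal)"
  shows "oadd 1 c = c"
proof -
  have "d < oadd 1 oomega \<longleftrightarrow> d < oomega" for d :: "'x ordinal"
  proof
    assume "d < oadd 1 oomega"
    then obtain n where "d \<le> (osucc ^^ n) 0"
      unfolding less_oadd_iff less_oomega_iff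
      by (metis funpow_0 one_oadd_finite ordinal_less_one_iff order_refl)
    then show "d < oomega" unfolding less_oomega_iff by (rule le_finite_ordinalE) blast
  qed (use le_oadd_right order_less_le_trans in blast)
  then have "oadd 1 oomega = (oomega :: 'x ordinal)" by (rule eqI_same_less)
  moreover obtain d where "c = oadd oomega d" using assms by (rule le_imp_oadd_eq)
  ultimately show ?thesis by (simp flip: oadd_assoc)
qed

subsection \<open>Powers of \<open>\<omega>\<close>\<close>

lemma oadd_funpow_add:
  "(oadd a ^^ (m + n)) 0 = oadd ((oadd a ^^ m) 0) ((oadd a ^^ n) (0 :: 'x::infinite ordinal))"
  by (induction m) (simp_all add: oadd_assoc)

lemma oadd_funpow_mono:
  "a \<le> b \<Longrightarrow> (oadd a ^^ n) 0 \<le> (oadd b ^^ n) (0 :: 'x::infinite ordinal)"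
  by (induction n) (simp_all add: oadd_mono)

lemma omult_osucc: "omult a (osucc b) = oadd (omult a b) (a :: 'x::infinite ordinal)"
proof -
  have mono: "omult a c \<le> omult a b" if "c \<le> b" for c
    using less_omult_iff[of _ a c] less_omult_iff[of _ a b] that
    by (meson leI order_less_irrefl order_less_le_trans)
  have "d < omult a (osucc b) \<longleftrightarrow> d < oadd (omult a b) a" for d
    unfolding less_omult_iff[of d a "osucc b"] less_osucc_iff
    using mono oadd_mono_left order_less_le_trans by blast
  then show ?thesis by (rule eqI_same_less)
qed

lemma oadd_funpow_Suc: "(oadd a ^^ Suc n) 0 = oadd ((oadd a ^^ n) 0) (a :: 'x::infinite ordinal)"
  using oadd_funpow_add[of n 1 a] by simp

lemma omult_finite: "omult a ((osucc ^^ n) 0) = (oadd a ^^ n) (0 :: 'x::infinite ordinal)"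
proof (induction n)
  case 0
  show ?case by (rule eqI_same_less) (simp add: less_omult_iff)
next
  case (Suc n)
  then show ?case unfolding oadd_funpow_Suc by (simp add: omult_osucc)
qed

lemma less_omult_oomega_iff:
  "d < omult a oomega \<longleftrightarrow> (\<exists>n. d < (oadd a ^^ n) (0 :: 'x::infinite ordinal))"
proof -
  have "d < omult a oomega \<longleftrightarrow> (\<exists>n. d < (oadd a ^^ Suc n) 0)"
    unfolding less_omult_iff[of d a oomega] less_oomega_iff oadd_funpow_Suc
    by (auto simp flip: omult_finite)
  also have "\<dots> \<longleftrightarrow> (\<exists>n. d < (oadd a ^^ n) 0)"
    by (metis funpow_0 old.nat.exhaust ordinal_not_less_zero)
  finally show ?thesis .
qed

lemma less_oexp_omega_iff:
  "d < oexp_omega b \<longleftrightarrow>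
    d = 0 \<or> (\<exists>c<b. \<exists>n. d < (oadd (oexp_omega c) ^^ n) (0 :: 'x::infinite ordinal))"
  unfolding less_oexp_omega_iff_omult less_omult_oomega_iff ..

lemma oexp_omega_pos [simp]: "0 < oexp_omega (b :: 'x::infinite ordinal)"
  by (simp add: less_oexp_omega_iff)

lemma oadd_funpow_less_oexp_omega:
  assumes "c < (b :: 'x::infinite ordinal)"
  shows "(oadd (oexp_omega c) ^^ n) 0 < oexp_omega b"
proof -
  have "(oadd (oexp_omega c) ^^ n) 0 < (oadd (oexp_omega c) ^^ (n + 1)) 0"
    unfolding oadd_funpow_add
    using oadd_less_cancel_left[of "(oadd (oexp_omega c) ^^ n) 0" 0 "oexp_omega c"] by simp
  then show ?thesis using assms unfolding less_oexp_omega_iff[of _ b] by blast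
qed

lemma strict_mono_oexp_omega: "strict_mono (oexp_omega :: 'x::infinite ordinal \<Rightarrow> 'x ordinal)"
proof (rule strict_monoI)
  fix c b :: "'x ordinal" assume "c < b"
  then show "oexp_omega c < oexp_omega b" using oadd_funpow_less_oexp_omega[of c b 1] by simp
qed

lemma oexp_omega_less_iff [simp]: "oexp_omega c < oexp_omega b \<longleftrightarrow> c < (b :: 'x::infinite ordinal)"
  by (rule strict_mono_less[OF strict_mono_oexp_omega])

lemma oexp_omega_le_iff [simp]: "oexp_omega c \<le> oexp_omega b \<longleftrightarrow> c \<le> (b :: 'x::infinite ordinal)"
  by (rule strict_mono_less_eq[OF strict_mono_oexp_omega])

lemma le_oexp_omega: "b \<le> oexp_omega (b :: 'x::infinite ordinal)"
  by (rule le_strict_mono_wellorder[OF strict_mono_oexp_omega])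

lemma oexp_omega_0 [simp]: "oexp_omega 0 = (1 :: 'x::infinite ordinal)"
  by (rule eqI_same_less) (simp add: less_oexp_omega_iff)

lemma oadd_less_oexp_omega:
  assumes x: "x < oexp_omega b" and y: "y < oexp_omega (b :: 'x::infinite ordinal)"
  shows "oadd x y < oexp_omega b"
proof (cases "x = 0 \<or> y = 0")
  case True
  then show ?thesis using x y by auto
next
  case False
  obtain c m where c: "c < b" "x < (oadd (oexp_omega c) ^^ m) 0"
    using x False by (auto simp: less_oexp_omega_iff)
  obtain d n where d: "d < b" "y < (oadd (oexp_omega d) ^^ n) 0"
    using y False by (auto simp: less_oexp_omega_iff)
  let ?e = "oexp_omega (max c d)"
  have "x \<le> (oadd ?e ^^ m) 0" "y \<le> (oadd ?e ^^ n) 0"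
    using c(2) d(2) oadd_funpow_mono[of "oexp_omega c" ?e m] oadd_funpow_mono[of "oexp_omega d" ?e n]
    by auto
  then have "oadd x y \<le> (oadd ?e ^^ (m + n)) 0"
    unfolding oadd_funpow_add by (rule oadd_mono)
  also have "\<dots> < oexp_omega b" using c d by (intro oadd_funpow_less_oexp_omega) auto
  finally show ?thesis .
qed

section \<open>Cantor normal forms as multisets\<close>

definition cnf_mset :: "'x::infinite ordinal \<Rightarrow> 'x ordinal multiset" where
  "cnf_mset a = mset (cnf a)"

definition of_cnf_mset :: "'x::infinite ordinal multiset \<Rightarrow> 'x ordinal" where
  "of_cnf_mset M = cnf_eval (rev (sorted_list_of_multiset M))"

lemma cnf_eval_Nil [simp]: "cnf_eval [] = 0"
  by (simp add: cnf_eval_def zero_ordinal_def)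

lemma cnf_eval_Cons [simp]: "cnf_eval (b # bs) = oadd (oexp_omega b) (cnf_eval bs)"
  by (simp add: cnf_eval_def)

lemma cnf_eval_append:
  "cnf_eval (xs @ ys) = oadd (cnf_eval xs) (cnf_eval (ys :: 'x::infinite ordinal list))"
  by (induction xs) (simp_all add: oadd_assoc)

lemma cnf_eval_rev_sort: "cnf_eval (rev (sort xs)) = of_cnf_mset (mset xs)"
  by (simp add: of_cnf_mset_def sorted_list_of_multiset_mset)

lemma cnf_eval_sorted_wrt:
  assumes "sorted_wrt (\<ge>) bs"
  shows "cnf_eval bs = of_cnf_mset (mset bs)"
proof -
  have "sort (rev bs) = rev bs" using assms by (simp add: sorted_wrt_rev sorted_sort_id)
  then show ?thesis using cnf_eval_rev_sort[of "rev bs"] by simp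
qed

lemma of_cnf_mset_empty [simp]: "of_cnf_mset {#} = 0"
  by (simp add: of_cnf_mset_def)

lemma of_cnf_mset_add_max:
  assumes "\<forall>x\<in>#M. x \<le> m"
  shows "of_cnf_mset (add_mset m M) = oadd (oexp_omega m) (of_cnf_mset M)"
  using assms by (simp add: of_cnf_mset_def sorted_insort_is_snoc)

lemma of_cnf_mset_less_oexp_omega: "\<forall>x\<in>#M. x < e \<Longrightarrow> of_cnf_mset M < oexp_omega e"
proof (induction M rule: multiset_induct_max)
  case (add m M)
  then show ?case by (simp add: of_cnf_mset_add_max oadd_less_oexp_omega)
qed simp

lemma oexp_omega_le_of_cnf_mset: "e \<in># M \<Longrightarrow> oexp_omega e \<le> of_cnf_mset M"
proof (induction M rule: multiset_induct_max)
  case (add m M)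
  then have "oexp_omega e \<le> oexp_omega m" by auto
  also have "\<dots> \<le> of_cnf_mset (add_mset m M)" using add by (simp add: of_cnf_mset_add_max le_oadd_left)
  finally show ?case .
qed simp

lemma strict_mono_of_cnf_mset: "strict_mono of_cnf_mset"
proof (rule strict_monoI)
  fix M N :: "'a ordinal multiset"
  assume "M < N"
  then show "of_cnf_mset M < of_cnf_mset N"
  proof (induction N arbitrary: M rule: multiset_induct_max)
    case (add n N)
    have n_le: "oexp_omega n \<le> of_cnf_mset (add_mset n N)" by (rule oexp_omega_le_of_cnf_mset) simp
    have bounded: "x \<le> n" if "x \<in># M" for x
    proof (rule leI, rule notI)
      assume "n < x"
      then have "\<forall>y\<in>#add_mset n N. y < x" using add.hyps by auto
      then have "add_mset n N < M" using that by (intro ex_gt_imp_less_multiset) blast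
      then show False using add.prems by simp
    qed
    show ?case
    proof (cases "n \<in># M")
      case True
      then obtain M' where M: "M = add_mset n M'" by (rule mset_add)
      then have "of_cnf_mset M' < of_cnf_mset N" using add by simp
      then show ?thesis using M bounded add.hyps by (simp add: of_cnf_mset_add_max)
    next
      case False
      then have "\<forall>x\<in>#M. x < n" using bounded by (auto simp: order_le_less)
      then show ?thesis using of_cnf_mset_less_oexp_omega n_le order_less_le_trans by blast
    qed
  qed simp
qed

lemma less_oexp_omega_of_cnf_msetE:
  assumes "a < oexp_omega (b :: 'x::infinite ordinal)"
  obtains M where "of_cnf_mset M = a" "\<forall>x\<in>#M. x < b"
proof -
  have "\<exists>M. of_cnf_mset M = a \<and> (\<forall>x\<in>#M. x < b)"
    using assms
  proof (induction b arbitrary: a rule: less_induct)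
    case (less b)
    consider (zero) "a = 0" | (pos) c n where "c < b" "a < (oadd (oexp_omega c) ^^ n) 0"
      using less.prems by (auto simp: less_oexp_omega_iff)
    then show ?case
    proof cases
      case zero
      then show ?thesis by (auto intro: exI[of _ "{#}"])
    next
      case (pos c n)
      have "\<exists>M. of_cnf_mset M = a \<and> (\<forall>x\<in>#M. x \<le> c)"
        using pos(2)
      proof (induction n arbitrary: a)
        case (Suc n)
        show ?case
        proof (cases "a < oexp_omega c")
          case True
          then show ?thesis using less.IH[OF \<open>c < b\<close>] by (blast intro: less_imp_le)
        next
          case False
          then have "oexp_omega c \<le> a" by simp
          then obtain r where r: "a = oadd (oexp_omega c) r" by (rule le_imp_oadd_eq)
          then obtain M where "of_cnf_mset M = r" "\<forall>x\<in>#M. x \<le> c" using Suc by auto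
          then show ?thesis using r by (intro exI[of _ "add_mset c M"]) (auto simp: of_cnf_mset_add_max)
        qed
      qed simp
      then show ?thesis using \<open>c < b\<close> order_le_less_trans by blast
    qed
  qed
  then show thesis using that by blast
qed

lemma cnf_of_cnf_mset: "cnf (of_cnf_mset M) = rev (sorted_list_of_multiset M)"
proof -
  let ?bs = "rev (sorted_list_of_multiset M)"
  show ?thesis
    unfolding cnf_def
  proof (rule the_equality)
    show "sorted_wrt (\<ge>) ?bs \<and> cnf_eval ?bs = of_cnf_mset M"
      by (simp add: of_cnf_mset_def sorted_wrt_rev)
  next
    fix bs :: "'a ordinal list"
    assume bs: "sorted_wrt (\<ge>) bs \<and> cnf_eval bs = of_cnf_mset M"
    then have "of_cnf_mset (mset bs) = of_cnf_mset M" by (metis cnf_eval_sorted_wrt)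
    then have "mset bs = M" using strict_mono_of_cnf_mset strict_mono_eq by blast
    moreover have "sorted (rev bs)" using bs by (simp add: sorted_wrt_rev)
    ultimately show "bs = ?bs"
      by (metis mset_rev rev_rev_ident sorted_list_of_multiset_mset sorted_sort_id)
  qed
qed

lemma cnf_mset_of_cnf_mset [simp]: "cnf_mset (of_cnf_mset M) = M"
  by (simp add: cnf_mset_def cnf_of_cnf_mset)

lemma of_cnf_mset_cnf_mset [simp]: "of_cnf_mset (cnf_mset a) = a"
proof -
  have "a \<le> oexp_omega a" by (rule le_oexp_omega)
  also have "\<dots> < oexp_omega (osucc a)" by simp
  finally have "a < oexp_omega (osucc a)" .
  then obtain M where "of_cnf_mset M = a" by (rule less_oexp_omega_of_cnf_msetE)
  then show ?thesis by auto
qed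

lemma cnf_mset_eqI: "cnf_mset a = cnf_mset b \<Longrightarrow> a = b"
  by (metis of_cnf_mset_cnf_mset)

lemma less_iff_cnf_mset: "a < b \<longleftrightarrow> cnf_mset a < cnf_mset b"
  using strict_mono_less[OF strict_mono_of_cnf_mset, of "cnf_mset a" "cnf_mset b"] by simp

lemma le_iff_cnf_mset: "a \<le> b \<longleftrightarrow> cnf_mset a \<le> cnf_mset b"
  using strict_mono_less_eq[OF strict_mono_of_cnf_mset, of "cnf_mset a" "cnf_mset b"] by simp

lemma sorted_cnf: "sorted_wrt (\<ge>) (cnf (a :: 'x::infinite ordinal))"
  using cnf_of_cnf_mset[of "cnf_mset a"] by (simp add: sorted_wrt_rev)

lemma cnf_eval_cnf: "cnf_eval (cnf a) = (a :: 'x::infinite ordinal)"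
  using sorted_cnf[of a] by (simp add: cnf_eval_sorted_wrt flip: cnf_mset_def)

lemma cnf_mset_zero [simp]: "cnf_mset 0 = {#}"
  using cnf_mset_of_cnf_mset[of "{#}"] by simp

lemma cnf_mset_oexp_omega [simp]: "cnf_mset (oexp_omega e) = {#e#}"
  using cnf_mset_of_cnf_mset[of "{#e#}"] by (simp add: of_cnf_mset_add_max)

lemma less_oexp_omega_iff_cnf_mset: "a < oexp_omega e \<longleftrightarrow> (\<forall>x\<in>#cnf_mset a. x < e)"
  by (simp add: less_iff_cnf_mset)

section \<open>Natural sum and product\<close>

instantiation ordinal :: (infinite) comm_monoid_add
begin

definition plus_ordinal :: "'a ordinal \<Rightarrow> 'a ordinal \<Rightarrow> 'a ordinal" where
  "plus_ordinal = natural_sum"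

lemma cnf_mset_plus [simp]: "cnf_mset (a + b) = cnf_mset a + cnf_mset (b :: 'a ordinal)"
proof -
  have "a + b = of_cnf_mset (cnf_mset a + cnf_mset b)"
    by (simp add: plus_ordinal_def natural_sum_def cnf_eval_rev_sort cnf_mset_def)
  then show ?thesis by simp
qed

instance
  by standard (rule cnf_mset_eqI; simp)+

end

definition mset_sums :: "'a::comm_monoid_add multiset \<Rightarrow> 'a multiset \<Rightarrow> 'a multiset" where
  "mset_sums M N = (\<Sum>x\<in>#M. {#x + y. y \<in># N#})"

lemma mset_sums_empty_left [simp]: "mset_sums {#} N = {#}"
  by (simp add: mset_sums_def)

lemma mset_sums_add_left [simp]: "mset_sums (add_mset x M) N = {#x + y. y \<in># N#} + mset_sums M N"
  by (simp add: mset_sums_def)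

lemma mset_sums_union_left: "mset_sums (L + M) N = mset_sums L N + mset_sums M N"
  by (simp add: mset_sums_def)

lemma mset_sums_empty_right [simp]: "mset_sums M {#} = {#}"
  by (induction M) simp_all

lemma mset_sums_add_right: "mset_sums M (add_mset y N) = {#x + y. x \<in># M#} + mset_sums M N"
  by (induction M) (simp_all add: ac_simps)

lemma mset_sums_commute: "mset_sums M N = mset_sums N M"
  by (induction M) (simp_all add: mset_sums_add_right add.commute)

lemma mset_sums_image_left: "mset_sums {#x + y. y \<in># M#} N = {#x + y. y \<in># mset_sums M N#}"
  by (induction M) (auto simp: multiset.map_comp add.assoc intro!: image_mset_cong)

lemma mset_sums_assoc: "mset_sums (mset_sums L M) N = mset_sums L (mset_sums M N)"
  by (induction L) (simp_all add: mset_sums_union_left mset_sums_image_left)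

instantiation ordinal :: (infinite) comm_semiring_1
begin

definition times_ordinal :: "'a ordinal \<Rightarrow> 'a ordinal \<Rightarrow> 'a ordinal" where
  "times_ordinal = natural_prod"

lemma cnf_mset_times [simp]: "cnf_mset (a * b) = mset_sums (cnf_mset a) (cnf_mset (b :: 'a ordinal))"
proof -
  have "mset (concat (map (\<lambda>x. map ((+) x) ys) xs)) = mset_sums (mset xs) (mset ys)"
    for xs ys :: "'a ordinal list"
    by (induction xs) simp_all
  then have "a * b = of_cnf_mset (mset_sums (cnf_mset a) (cnf_mset b))"
    by (simp add: times_ordinal_def natural_prod_def cnf_eval_rev_sort cnf_mset_def
        flip: plus_ordinal_def)
  then show ?thesis by simp
qed

instance
proof
  fix a b c :: "'a ordinal"
  have one: "cnf_mset (1 :: 'a ordinal) = {#0#}" by (simp flip: oexp_omega_0)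
  show "a * b * c = a * (b * c)" by (rule cnf_mset_eqI) (simp add: mset_sums_assoc)
  show "a * b = b * a" by (rule cnf_mset_eqI) (simp add: mset_sums_commute)
  show "1 * a = a" by (rule cnf_mset_eqI) (simp add: one)
  show "(a + b) * c = a * c + b * c" by (rule cnf_mset_eqI) (simp add: mset_sums_union_left)
  show "0 * a = 0" by (rule cnf_mset_eqI) simp
  show "a * 0 = 0" by (rule cnf_mset_eqI) simp
  show "(0 :: 'a ordinal) \<noteq> 1" using one cnf_mset_zero by (metis add_mset_not_empty)
qed

end

instance ordinal :: (infinite) ordered_comm_monoid_add
  by standard (simp add: le_iff_cnf_mset)

lemma ordinal_add_less_cancel_left [simp]: "c + a < c + b \<longleftrightarrow> a < (b :: 'x::infinite ordinal)"
  by (simp add: less_iff_cnf_mset)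

lemma ordinal_add_less_cancel_right [simp]: "a + c < b + c \<longleftrightarrow> a < (b :: 'x::infinite ordinal)"
  by (simp add: less_iff_cnf_mset)

lemma sum_fun_upd_less:
  assumes "finite I" "k \<in> I" "d < (b k :: 'x::infinite ordinal)"
  shows "(\<Sum>i\<in>I. (b(k := d)) i) < (\<Sum>i\<in>I. b i)"
proof -
  have "(\<Sum>i\<in>I - {k}. (b(k := d)) i) = (\<Sum>i\<in>I - {k}. b i)" by (rule sum.cong) auto
  then show ?thesis using assms by (simp add: sum.remove[of I k])
qed

lemma oexp_omega_add: "oexp_omega (a + b) = oexp_omega a * oexp_omega (b :: 'x::infinite ordinal)"
  by (rule cnf_mset_eqI) simp

lemma oexp_omega_sum:
  "oexp_omega (\<Sum>k\<in>I. f k) = (\<Prod>k\<in>I. oexp_omega (f k :: 'x::infinite ordinal))"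
  by (induction I rule: infinite_finite_induct) (simp_all add: oexp_omega_add)

lemma add_less_oexp_omega:
  "a < oexp_omega e \<Longrightarrow> b < oexp_omega e \<Longrightarrow> a + b < oexp_omega (e :: 'x::infinite ordinal)"
  by (auto simp: less_oexp_omega_iff_cnf_mset)

lemma sum_less_oexp_omega:
  "(\<And>k. k \<in> I \<Longrightarrow> f k < oexp_omega e) \<Longrightarrow> (\<Sum>k\<in>I. f k) < oexp_omega (e :: 'x::infinite ordinal)"
  by (induction I rule: infinite_finite_induct) (auto simp: add_less_oexp_omega)

lemma oadd_eq_add:
  assumes "\<forall>x\<in>#cnf_mset a. \<forall>y\<in>#cnf_mset b. y \<le> x"
  shows "oadd a b = a + b"
proof -
  have "oadd (of_cnf_mset M) b = of_cnf_mset M + b" if "\<forall>x\<in>#M. \<forall>y\<in>#cnf_mset b. y \<le> x" for M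
    using that
  proof (induction M rule: multiset_induct_max)
    case (add m M)
    then have IH: "oadd (of_cnf_mset M) b = of_cnf_mset M + b" by simp
    have "of_cnf_mset M + b = of_cnf_mset (M + cnf_mset b)" by (rule cnf_mset_eqI) simp
    then have "oadd (of_cnf_mset (add_mset m M)) b = oadd (oexp_omega m) (of_cnf_mset (M + cnf_mset b))"
      using add.hyps IH by (simp add: of_cnf_mset_add_max oadd_assoc)
    also have "\<dots> = of_cnf_mset (add_mset m (M + cnf_mset b))"
      using add by (subst of_cnf_mset_add_max) auto
    also have "\<dots> = of_cnf_mset (add_mset m M) + b" by (rule cnf_mset_eqI) simp
    finally show ?case .
  qed simp
  from this[of "cnf_mset a"] assms show ?thesis by simp
qed

lemma oadd_funpow_oexp_omega:
  "(oadd (oexp_omega e) ^^ n) 0 = of_nat n * oexp_omega (e :: 'x::infinite ordinal)"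
proof (induction n)
  case (Suc n)
  have "\<forall>y\<in>#cnf_mset (of_nat n * oexp_omega e). y \<le> e"
    by (induction n) (auto simp: distrib_right)
  then have "oadd (oexp_omega e) (of_nat n * oexp_omega e) = oexp_omega e + of_nat n * oexp_omega e"
    by (intro oadd_eq_add) simp
  then show ?case using Suc by (simp add: distrib_right)
qed simp

lemma of_nat_times_oexp_omega_mono:
  "s \<le> t \<Longrightarrow> of_nat n * oexp_omega s \<le> of_nat n * oexp_omega (t :: 'x::infinite ordinal)"
  unfolding oadd_funpow_oexp_omega[symmetric] by (rule oadd_funpow_mono) simp

lemma less_oexp_omega_iff_of_nat_times:
  "d < oexp_omega e \<longleftrightarrow>
    d = 0 \<or> (\<exists>c<e. \<exists>n. d < of_nat n * oexp_omega (c :: 'x::infinite ordinal))"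
  unfolding less_oexp_omega_iff oadd_funpow_oexp_omega ..

lemma of_nat_times_less_oexp_omega:
  "c < e \<Longrightarrow> of_nat n * oexp_omega c < oexp_omega (e :: 'x::infinite ordinal)"
  using oadd_funpow_less_oexp_omega[of c e n] by (simp only: oadd_funpow_oexp_omega)

lemma cnf_of_nat_times_oexp_omega:
  "cnf (of_nat n * oexp_omega e) = replicate n (e :: 'x::infinite ordinal)"
proof -
  have "cnf_mset (of_nat n * oexp_omega e) = replicate_mset n e"
    by (induction n) (simp_all add: distrib_right)
  then have "mset (cnf (of_nat n * oexp_omega e)) = replicate_mset n e" by (simp add: cnf_mset_def)
  then show ?thesis
    by (metis in_replicate_mset replicate_eqI set_mset_mset size_mset size_replicate_mset)
qed

lemma cnf_oexp_omega [simp]: "cnf (oexp_omega e) = [e :: 'x::infinite ordinal]"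
  using cnf_of_nat_times_oexp_omega[of 1 e] by simp

lemma cnf_mset_sum_list_oexp_omega: "cnf_mset (\<Sum>e\<leftarrow>es. oexp_omega e) = mset es"
  by (induction es) simp_all

lemma sum_oexp_omega_cnf:
  "(\<Sum>p<length (cnf a). oexp_omega (cnf a ! p)) = (a :: 'x::infinite ordinal)"
proof -
  have "(\<Sum>e\<leftarrow>cnf a. oexp_omega e) = a"
    by (rule cnf_mset_eqI, subst cnf_mset_sum_list_oexp_omega) (rule cnf_mset_def[symmetric])
  then show ?thesis by (simp add: sum_list_sum_nth atLeast0LessThan)
qed

lemma less_union_multisetE:
  fixes S A B :: "'a::linorder multiset"
  assumes "S < A + B"
  obtains (left) A' where "A' < A" "S \<le> A' + B" | (right) B' where "B' < B" "S \<le> A + B'"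
proof -
  obtain X Y where X: "X \<noteq> {#}" "X \<subseteq># A + B" and S: "S = A + B - X + Y"
    and Y: "\<forall>y\<in>#Y. \<exists>x\<in>#X. y < x"
    using assms unfolding less_multiset\<^sub>D\<^sub>M by blast
  let ?m = "Max_mset X"
  have m: "?m \<in># X" using X(1) by simp
  have below: "\<forall>y\<in>#Y. y < ?m"
    using Y by (metis Max_ge finite_set_mset order_less_le_trans)
  have replace: "C - {#?m#} + Y < C" "S \<le> C - {#?m#} + Y + D" if "?m \<in># C" "A + B = C + D" for C D
  proof -
    show "C - {#?m#} + Y < C"
      unfolding less_multiset\<^sub>D\<^sub>M using that(1) below by (intro exI[of _ "{#?m#}"] exI[of _ Y]) auto
    obtain X' where "X = add_mset ?m X'" using m by (rule mset_add)
    then have "A + B - X \<subseteq># A + B - {#?m#}"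
      by (metis add_mset_add_single diff_diff_add_mset diff_subset_eq_self union_commute)
    then have "S \<subseteq># A + B - {#?m#} + Y" unfolding S by simp
    also have "A + B - {#?m#} + Y = C - {#?m#} + Y + D" using that by (auto dest!: multi_member_split)
    finally show "S \<le> C - {#?m#} + Y + D" by (rule subset_eq_imp_le_multiset)
  qed
  have "?m \<in># A + B" using X(2) m by (rule mset_subset_eqD)
  then consider (left) "?m \<in># A" | (right) "?m \<in># B" by auto
  then show thesis
  proof cases
    case left
    then show thesis using replace[of A B] that(1) by blast
  next
    case right
    then show thesis using replace[of B A] that(2)[of "B - {#?m#} + Y"] by (simp add: add.commute)
  qed
qed

lemma less_add_ordinalE:
  assumes "s < a + (b :: 'x::infinite ordinal)"
  obtains (left) a' where "a' < a" "s \<le> a' + b" | (right) b' where "b' < b" "s \<le> a + b'"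
proof -
  have "cnf_mset s < cnf_mset a + cnf_mset b" using assms by (simp add: less_iff_cnf_mset)
  then show thesis
  proof (cases rule: less_union_multisetE)
    case (left A')
    then show thesis using that(1)[of "of_cnf_mset A'"] by (simp add: less_iff_cnf_mset le_iff_cnf_mset)
  next
    case (right B')
    then show thesis using that(2)[of "of_cnf_mset B'"] by (simp add: less_iff_cnf_mset le_iff_cnf_mset)
  qed
qed

lemma less_sum_ordinalE:
  assumes "finite I" "s < (\<Sum>k\<in>I. c k :: 'x::infinite ordinal)"
  obtains i d where "i \<in> I" "d < c i" "s \<le> (\<Sum>k\<in>I. (c(i := d)) k)"
proof -
  have "\<exists>i\<in>I. \<exists>d<c i. s \<le> (\<Sum>k\<in>I. (c(i := d)) k)"
    using assms
  proof (induction I arbitrary: s rule: finite_induct)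
    case (insert x I)
    have unchanged: "(\<Sum>k\<in>I. (c(x := d)) k) = (\<Sum>k\<in>I. c k)" for d
      using insert.hyps by (intro sum.cong) auto
    have "s < c x + (\<Sum>k\<in>I. c k)" using insert by simp
    then show ?case
    proof (cases rule: less_add_ordinalE)
      case (left a)
      then show ?thesis using insert unchanged[of a] by (intro bexI[of _ x] exI[of _ a]) auto
    next
      case (right b)
      obtain i d where i: "i \<in> I" "d < c i" "b \<le> (\<Sum>k\<in>I. (c(i := d)) k)"
        using insert.IH[OF right(1)] by blast
      then have "s \<le> c x + (\<Sum>k\<in>I. (c(i := d)) k)" using right(2) add_left_mono order_trans by blast
      then show ?thesis using i insert by (intro bexI[of _ i] exI[of _ d]) auto
    qed
  qed simp
  then show thesis using that by blast
qed

section \<open>Ranks of forests of sequences\<close>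

definition residual :: "('b \<Rightarrow> 'b \<Rightarrow> bool) \<Rightarrow> 'b set \<Rightarrow> 'b set \<Rightarrow> 'b set" where
  "residual Q A F = {y \<in> A. \<forall>x\<in>F. Q x y}"

lemma in_residual_iff [simp]: "y \<in> residual Q A F \<longleftrightarrow> y \<in> A \<and> (\<forall>x\<in>F. Q x y)"
  by (simp add: residual_def)

lemma residual_empty [simp]: "residual Q A {} = A"
  by auto

lemma residual_subset: "residual Q A F \<subseteq> A"
  by auto

lemma residual_mono: "A \<subseteq> A' \<Longrightarrow> residual Q A F \<subseteq> residual Q A' F"
  by auto

lemma residual_Un: "residual Q (A \<union> B) F = residual Q A F \<union> residual Q B F"
  by auto

lemma residual_residual: "residual Q (residual Q A F) {x} = residual Q A (insert x F)"
  by auto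

text \<open>The rank meant is that of the forest of nonempty sequences in \<^term>\<open>A\<close> in which every element is
  related by \<^term>\<open>Q\<close> to all later ones: after a first move \<^term>\<open>x\<close> the play continues in the residual.\<close>
inductive rank_le :: "('b \<Rightarrow> 'b \<Rightarrow> bool) \<Rightarrow> 'b set \<Rightarrow> 'x ordinal \<Rightarrow> bool" for Q where
  rank_leI: "(\<And>x. x \<in> A \<Longrightarrow> \<exists>b<a. rank_le Q (residual Q A {x}) b) \<Longrightarrow> rank_le Q A a"

inductive rank_ge :: "('b \<Rightarrow> 'b \<Rightarrow> bool) \<Rightarrow> 'b set \<Rightarrow> 'x ordinal \<Rightarrow> bool" for Q where
  rank_geI: "(\<And>b. b < a \<Longrightarrow> \<exists>x\<in>A. rank_ge Q (residual Q A {x}) b) \<Longrightarrow> rank_ge Q A a"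

definition has_rank :: "('b \<Rightarrow> 'b \<Rightarrow> bool) \<Rightarrow> 'b set \<Rightarrow> 'x ordinal \<Rightarrow> bool" where
  "has_rank Q A a \<longleftrightarrow> rank_le Q A a \<and> rank_ge Q A a"

lemma rank_leE:
  assumes "rank_le Q A a" "x \<in> A"
  obtains b where "b < a" "rank_le Q (residual Q A {x}) b"
  using assms by (auto elim: rank_le.cases)

lemma rank_geE:
  assumes "rank_ge Q A a" "b < a"
  obtains x where "x \<in> A" "rank_ge Q (residual Q A {x}) b"
  using assms by (auto elim: rank_ge.cases)

lemma has_rankD: "has_rank Q A a \<Longrightarrow> rank_le Q A a" "has_rank Q A a \<Longrightarrow> rank_ge Q A a"
  by (simp_all add: has_rank_def)

lemma rank_le_mono:
  assumes "rank_le Q A a" "A' \<subseteq> A" "a \<le> a'" "\<And>x y. x \<in> A' \<Longrightarrow> y \<in> A' \<Longrightarrow> Q' x y \<Longrightarrow> Q x y"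
  shows "rank_le Q' A' a'"
  using assms
proof (induction a arbitrary: A A' a' rule: less_induct)
  case (less a)
  show ?case
  proof (rule rank_leI)
    fix x assume x: "x \<in> A'"
    then have "x \<in> A" using less.prems(2) by blast
    with less.prems(1) obtain b where b: "b < a" "rank_le Q (residual Q A {x}) b"
      by (rule rank_leE)
    have "rank_le Q' (residual Q' A' {x}) b"
      using less.prems x by (intro less.IH[OF b]) auto
    then show "\<exists>b<a'. rank_le Q' (residual Q' A' {x}) b"
      using b(1) less.prems(3) by (meson order_less_le_trans)
  qed
qed

lemma rank_ge_mono:
  assumes "rank_ge Q A a" "A \<subseteq> A'" "a' \<le> a"
  shows "rank_ge Q A' a'"
  using assms
proof (induction a' arbitrary: A A' a rule: less_induct)
  case (less a')
  show ?case
  proof (rule rank_geI)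
    fix b assume b: "b < a'"
    then have "b < a" using less.prems by simp
    with less.prems(1) obtain x where x: "x \<in> A" "rank_ge Q (residual Q A {x}) b"
      by (rule rank_geE)
    have "rank_ge Q (residual Q A' {x}) b"
      using less.IH[OF b x(2)] less.prems(2) by (simp add: residual_mono)
    then show "\<exists>x\<in>A'. rank_ge Q (residual Q A' {x}) b"
      using x(1) less.prems(2) by blast
  qed
qed

lemma rank_ge_le_rank_le:
  assumes "rank_le Q A a" "rank_ge Q A b"
  shows "b \<le> a"
  using assms
proof (induction a arbitrary: A b rule: less_induct)
  case (less a)
  show ?case
  proof (rule leI, rule notI)
    assume "a < b"
    with less.prems(2) obtain x where x: "x \<in> A" "rank_ge Q (residual Q A {x}) a"
      by (rule rank_geE)
    obtain c where c: "c < a" "rank_le Q (residual Q A {x}) c"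
      using less.prems(1) x(1) by (rule rank_leE)
    then have "a \<le> c" using less.IH x(2) by blast
    then show False using c(1) by simp
  qed
qed

lemma has_rank_unique: "has_rank Q A a \<Longrightarrow> has_rank Q A b \<Longrightarrow> a = b"
  unfolding has_rank_def by (meson order.antisym rank_ge_le_rank_le)

lemma rank_le_or_rank_ge: "rank_le Q A a \<or> rank_ge Q A (osucc (a :: 'x::infinite ordinal))"
proof (induction a arbitrary: A rule: less_induct)
  case (less a)
  show ?case
  proof (cases "\<exists>x\<in>A. \<forall>b<a. rank_ge Q (residual Q A {x}) (osucc b)")
    case True
    then obtain x where x: "x \<in> A" "\<And>b. b < a \<Longrightarrow> rank_ge Q (residual Q A {x}) (osucc b)" by blast
    have "rank_ge Q (residual Q A {x}) a"
    proof (rule rank_geI)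
      fix b assume "b < a"
      then show "\<exists>y\<in>residual Q A {x}. rank_ge Q (residual Q (residual Q A {x}) {y}) b"
        by (rule rank_geE[OF x(2), of _ b]) auto
    qed
    then have "rank_ge Q A (osucc a)"
      using x(1) by (intro rank_geI) (auto intro: rank_ge_mono)
    then show ?thesis ..
  next
    case False
    then have "rank_le Q A a" using less.IH by (intro rank_leI) blast
    then show ?thesis ..
  qed
qed

lemma has_rank_exists:
  assumes "rank_le Q A (a :: 'x::infinite ordinal)"
  obtains b where "b \<le> a" "has_rank Q A b"
proof -
  let ?b = "LEAST b :: 'x ordinal. rank_le Q A b"
  have upper: "rank_le Q A ?b" using assms by (rule LeastI[of "rank_le Q A"])
  have "rank_ge Q A ?b"
  proof (rule rank_geI)
    fix c assume "c < ?b"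
    then have "rank_ge Q A (osucc c)" using rank_le_or_rank_ge not_less_Least by blast
    then show "\<exists>x\<in>A. rank_ge Q (residual Q A {x}) c" by (rule rank_geE[of _ _ _ c]) auto
  qed
  then show thesis using that[of ?b] upper assms by (simp add: has_rank_def Least_le)
qed

lemma has_rank_subset:
  assumes "has_rank Q A (a :: 'x::infinite ordinal)" "A' \<subseteq> A"
  obtains b where "b \<le> a" "has_rank Q A' b"
proof -
  have "rank_le Q A' a" using has_rankD(1)[OF assms(1)] assms(2) by (rule rank_le_mono) auto
  then show thesis using that by (rule has_rank_exists)
qed

lemma has_rank_residualE:
  assumes "has_rank Q A (a :: 'x::infinite ordinal)" "b < a"
  obtains x c where "x \<in> A" "b \<le> c" "c < a" "has_rank Q (residual Q A {x}) c"
proof -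
  obtain x where x: "x \<in> A" "rank_ge Q (residual Q A {x}) b"
    using has_rankD(2)[OF assms(1)] assms(2) by (rule rank_geE)
  obtain d where d: "d < a" "rank_le Q (residual Q A {x}) d"
    using has_rankD(1)[OF assms(1)] x(1) by (rule rank_leE)
  obtain c where c: "c \<le> d" "has_rank Q (residual Q A {x}) c"
    using d(2) by (rule has_rank_exists)
  then have "b \<le> c" using x(2) rank_ge_le_rank_le has_rankD(1) by blast
  then show thesis using that[of x c] x(1) c d(1) by simp
qed

lemma rank_le_empty [simp]: "rank_le Q {} a"
  by (rule rank_leI) simp

lemma rank_le_one:
  assumes "\<And>x y. x \<in> A \<Longrightarrow> y \<in> A \<Longrightarrow> \<not> Q x y"
  shows "rank_le Q A (1 :: 'x::infinite ordinal)"
proof (rule rank_leI)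
  fix x assume "x \<in> A"
  then have "residual Q A {x} = {}" using assms by auto
  then show "\<exists>b<1. rank_le Q (residual Q A {x}) (b :: 'x ordinal)" by simp
qed

lemma rank_ge_zero [simp]: "rank_ge Q A 0"
  by (rule rank_geI) simp

lemma rank_le_zero_iff [simp]: "rank_le Q A 0 \<longleftrightarrow> A = {}"
  by (subst rank_le.simps) auto

lemma rank_ge_nonempty: "rank_ge Q A a \<Longrightarrow> 0 < a \<Longrightarrow> A \<noteq> {}"
  by (subst (asm) rank_ge.simps) blast

lemma rank_le_Un:
  assumes "rank_le Q X a" "rank_le Q Y (b :: 'x::infinite ordinal)"
  shows "rank_le Q (X \<union> Y) (a + b)"
  using assms
proof (induction "a + b" arbitrary: X Y a b rule: less_induct)
  case less
  show ?case
  proof (rule rank_leI)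
    fix z assume "z \<in> X \<union> Y"
    have res: "rank_le Q (residual Q X {z}) a" "rank_le Q (residual Q Y {z}) b"
      by (rule rank_le_mono[OF less.prems(1)] rank_le_mono[OF less.prems(2)];
          simp add: residual_subset)+
    from \<open>z \<in> X \<union> Y\<close> consider (left) "z \<in> X" | (right) "z \<in> Y" by blast
    then show "\<exists>c<a + b. rank_le Q (residual Q (X \<union> Y) {z}) c"
    proof cases
      case left
      with less.prems(1) obtain c where c: "c < a" "rank_le Q (residual Q X {z}) c"
        by (rule rank_leE)
      then have "rank_le Q (residual Q (X \<union> Y) {z}) (c + b)"
        unfolding residual_Un using res(2) by (intro less.hyps) auto
      then show ?thesis using c(1) ordinal_add_less_cancel_right by blast
    next
      case right
      with less.prems(2) obtain c where c: "c < b" "rank_le Q (residual Q Y {z}) c"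
        by (rule rank_leE)
      then have "rank_le Q (residual Q (X \<union> Y) {z}) (a + c)"
        unfolding residual_Un using res(1) by (intro less.hyps) auto
      then show ?thesis using c(1) ordinal_add_less_cancel_left by blast
    qed
  qed
qed

lemma rank_le_UN:
  assumes "finite S" "\<And>p. p \<in> S \<Longrightarrow> rank_le Q (X p) (f p :: 'x::infinite ordinal)"
  shows "rank_le Q (\<Union>p\<in>S. X p) (\<Sum>p\<in>S. f p)"
  using assms by (induction S rule: finite_induct) (simp_all add: rank_le_Un)

text \<open>Play in \<^term>\<open>Y\<close> first; the finitely many moves made there leave enough room in \<^term>\<open>X\<close>.\<close>
lemma rank_ge_Un_avoiding:
  assumes "rank_ge Q Y (b :: 'x::infinite ordinal)"
    and avoid: "\<And>F. finite F \<Longrightarrow> F \<subseteq> Y \<Longrightarrow> rank_ge Q (residual Q X F) a"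
  shows "rank_ge Q (X \<union> Y) (oadd a b)"
proof -
  have "rank_ge Q (residual Q X F \<union> Y') (oadd a b)"
    if "rank_ge Q Y' b" "Y' \<subseteq> Y" "finite F" "F \<subseteq> Y" for Y' F
    using that
  proof (induction b arbitrary: Y' F rule: less_induct)
    case (less b)
    let ?Z = "residual Q X F \<union> Y'"
    show ?case
    proof (rule rank_geI)
      fix d assume "d < oadd a b"
      then consider (in_Y) c where "c < b" "d \<le> oadd a c" | (in_X) "d < a"
        unfolding less_oadd_iff[of d a b] by blast
      then show "\<exists>x\<in>?Z. rank_ge Q (residual Q ?Z {x}) d"
      proof cases
        case (in_Y c)
        obtain y where y: "y \<in> Y'" "rank_ge Q (residual Q Y' {y}) c"
          using less.prems(1) in_Y(1) by (rule rank_geE)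
        have "rank_ge Q (residual Q X (insert y F) \<union> residual Q Y' {y}) (oadd a c)"
          using less.prems y in_Y(1) by (intro less.IH) auto
        then have "rank_ge Q (residual Q ?Z {y}) d"
          by (rule rank_ge_mono) (use in_Y(2) in auto)
        then show ?thesis using y(1) by blast
      next
        case in_X
        obtain x where x: "x \<in> residual Q X F" "rank_ge Q (residual Q (residual Q X F) {x}) d"
          using avoid[OF less.prems(3,4)] in_X by (rule rank_geE)
        have "rank_ge Q (residual Q ?Z {x}) d"
          by (rule rank_ge_mono[OF x(2)]) auto
        then show ?thesis using x(1) by blast
      qed
    qed
  qed
  from this[OF assms(1), of "{}"] show ?thesis by simp
qed

section \<open>Maximal order types\<close>

abbreviation (input) incomp :: "('b \<Rightarrow> 'b \<Rightarrow> bool) \<Rightarrow> 'b \<Rightarrow> 'b \<Rightarrow> bool" where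
  "incomp le x y \<equiv> \<not> le x y \<and> \<not> le y x"

abbreviation (input) not_above :: "('b \<Rightarrow> 'b \<Rightarrow> bool) \<Rightarrow> 'b set \<Rightarrow> 'b \<Rightarrow> 'b set" where
  "not_above le A x \<equiv> residual (\<lambda>x y. \<not> le x y) A {x}"

abbreviation (input) not_below :: "('b \<Rightarrow> 'b \<Rightarrow> bool) \<Rightarrow> 'b set \<Rightarrow> 'b set \<Rightarrow> 'b set" where
  "not_below le A F \<equiv> residual (\<lambda>x y. \<not> le y x) A F"

abbreviation (input) not_comparable :: "('b \<Rightarrow> 'b \<Rightarrow> bool) \<Rightarrow> 'b set \<Rightarrow> 'b set \<Rightarrow> 'b set" where
  "not_comparable le A F \<equiv> residual (incomp le) A F"

abbreviation (input) mot_le :: "('b \<Rightarrow> 'b \<Rightarrow> bool) \<Rightarrow> 'b set \<Rightarrow> 'x ordinal \<Rightarrow> bool" where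
  "mot_le le \<equiv> rank_le (\<lambda>x y. \<not> le x y)"

abbreviation (input) has_mot :: "('b \<Rightarrow> 'b \<Rightarrow> bool) \<Rightarrow> 'b set \<Rightarrow> 'x ordinal \<Rightarrow> bool" where
  "has_mot le \<equiv> has_rank (\<lambda>x y. \<not> le x y)"

abbreviation (input) width_ge :: "('b \<Rightarrow> 'b \<Rightarrow> bool) \<Rightarrow> 'b set \<Rightarrow> 'x ordinal \<Rightarrow> bool" where
  "width_ge le \<equiv> rank_ge (incomp le)"

definition nowhere_le :: "('b \<Rightarrow> 'b \<Rightarrow> bool) \<Rightarrow> 'b set \<Rightarrow> 'b set \<Rightarrow> bool" where
  "nowhere_le le B C \<longleftrightarrow> (\<forall>x\<in>B. \<forall>y\<in>C. \<not> le x y)"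

definition down_closed_in :: "('b \<Rightarrow> 'b \<Rightarrow> bool) \<Rightarrow> 'b set \<Rightarrow> 'b set \<Rightarrow> bool" where
  "down_closed_in le A D \<longleftrightarrow> D \<subseteq> A \<and> nowhere_le le (A - D) D"

lemma down_closed_in_trans: "down_closed_in le B D \<Longrightarrow> down_closed_in le A B \<Longrightarrow> down_closed_in le A D"
  unfolding down_closed_in_def nowhere_le_def by blast

lemma down_closed_in_not_above:
  "transp_on A le \<Longrightarrow> x \<in> A \<Longrightarrow> down_closed_in le A (not_above le A x)"
  unfolding down_closed_in_def nowhere_le_def by (auto dest: transp_onD)

lemma has_mot_down_closed_in:
  assumes "has_mot le A (a :: 'x::infinite ordinal)" "g \<le> a" "transp_on A le"
  obtains D where "down_closed_in le A D" "has_mot le D g"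
proof -
  have "\<exists>D. down_closed_in le A D \<and> has_mot le D g"
    using assms
  proof (induction a arbitrary: A rule: less_induct)
    case (less a)
    show ?case
    proof (cases "g = a")
      case True
      moreover have "down_closed_in le A A" by (simp add: down_closed_in_def nowhere_le_def)
      ultimately show ?thesis using less.prems(1) by blast
    next
      case False
      then have "g < a" using less.prems by simp
      with less.prems(1) obtain x c where x: "x \<in> A"
        and c: "g \<le> c" "c < a" "has_mot le (not_above le A x) c"
        by (rule has_rank_residualE)
      have "transp_on (not_above le A x) le"
        using less.prems(3) residual_subset by (rule transp_on_subset)
      with less.IH[OF c(2,3,1)] obtain D where
        D: "down_closed_in le (not_above le A x) D" "has_mot le D g" by blast
      have "down_closed_in le A (not_above le A x)"
        using less.prems(3) x by (rule down_closed_in_not_above)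
      with D(1) have "down_closed_in le A D" by (rule down_closed_in_trans)
      then show ?thesis using D(2) by blast
    qed
  qed
  then show thesis using that by blast
qed

lemma has_mot_diff_down_closed_in:
  assumes mot: "has_mot le A (oadd g (oexp_omega (m :: 'x::infinite ordinal)))"
    and D: "down_closed_in le A D" "has_mot le D g" and min: "\<forall>x\<in>#cnf_mset g. m \<le> x"
  shows "has_mot le (A - D) (oexp_omega m)"
proof -
  obtain v where "v \<le> oadd g (oexp_omega m)" and v: "has_mot le (A - D) v"
    using mot Diff_subset by (rule has_rank_subset)
  have A_eq: "D \<union> (A - D) = A" using D(1) by (auto simp: down_closed_in_def)
  have "rank_ge (\<lambda>x y. \<not> le x y) (D \<union> (A - D)) (oadd g v)"
  proof (rule rank_ge_Un_avoiding[OF has_rankD(2)[OF v]])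
    fix F assume "F \<subseteq> A - D"
    then have "residual (\<lambda>x y. \<not> le x y) D F = D"
      using D(1) unfolding down_closed_in_def nowhere_le_def residual_def by blast
    then show "rank_ge (\<lambda>x y. \<not> le x y) (residual (\<lambda>x y. \<not> le x y) D F) g"
      using has_rankD(2)[OF D(2)] by simp
  qed
  then have "oadd g v \<le> oadd g (oexp_omega m)"
    unfolding A_eq using has_rankD(1)[OF mot] by (rule rank_ge_le_rank_le[rotated])
  then have "v \<le> oexp_omega m" by simp
  moreover have "\<not> v < oexp_omega m"
  proof
    assume v_less: "v < oexp_omega m"
    then have "oadd g v = g + v"
      using min unfolding less_oexp_omega_iff_cnf_mset
      by (intro oadd_eq_add) (meson less_imp_le order_less_le_trans)
    moreover have "mot_le le (D \<union> (A - D)) (g + v)"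
      using D(2) v by (intro rank_le_Un has_rankD)
    ultimately have "oadd g (oexp_omega m) \<le> oadd g v"
      unfolding A_eq using has_rankD(2)[OF mot] by (metis rank_ge_le_rank_le)
    then show False using v_less by simp
  qed
  ultimately show ?thesis using v by simp
qed

definition cnf_partition ::
    "('b \<Rightarrow> 'b \<Rightarrow> bool) \<Rightarrow> 'b set \<Rightarrow> 'x::infinite ordinal list \<Rightarrow> 'b set list \<Rightarrow> bool" where
  "cnf_partition le A es Bs \<longleftrightarrow>
    \<Union>(set Bs) = A \<and> list_all2 (\<lambda>B e. has_mot le B (oexp_omega e)) Bs es \<and>
    sorted_wrt (\<lambda>C B. nowhere_le le B C) Bs"

lemma cnf_partition_exists_cnf_eval:
  assumes "sorted_wrt (\<ge>) es" "has_mot le A (cnf_eval (es :: 'x::infinite ordinal list))" "transp_on A le"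
  obtains Bs where "cnf_partition le A es Bs"
proof -
  from assms have "\<exists>Bs. cnf_partition le A es Bs"
  proof (induction es arbitrary: A rule: rev_induct)
    case Nil
    then have "A = {}" by (simp add: has_rank_def)
    then show ?case by (auto simp: cnf_partition_def)
  next
    case (snoc m es)
    let ?g = "cnf_eval es"
    have es: "sorted_wrt (\<ge>) es" and min: "\<forall>e\<in>set es. m \<le> e"
      using snoc.prems(1) by (auto simp: sorted_wrt_append)
    have g: "cnf_mset ?g = mset es" using es by (simp add: cnf_eval_sorted_wrt)
    have mot: "has_mot le A (oadd ?g (oexp_omega m))"
      using snoc.prems(2) by (simp add: cnf_eval_append)
    then obtain D where D: "down_closed_in le A D" "has_mot le D ?g"
      using le_oadd_left snoc.prems(3) by (rule has_mot_down_closed_in)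
    then have "D \<subseteq> A" by (simp add: down_closed_in_def)
    then have "transp_on D le" using snoc.prems(3) transp_on_subset by blast
    then obtain Bs where Bs: "cnf_partition le D es Bs" using snoc.IH[OF es D(2)] by blast
    have "has_mot le (A - D) (oexp_omega m)"
      using mot D by (rule has_mot_diff_down_closed_in) (use min g in simp)
    then have "cnf_partition le A (es @ [m]) (Bs @ [A - D])"
      using Bs D(1) unfolding cnf_partition_def down_closed_in_def
      by (auto simp: sorted_wrt_append nowhere_le_def intro: list_all2_appendI)
    then show ?case by blast
  qed
  then show thesis using that by blast
qed

lemma cnf_partition_exists:
  assumes "has_mot le A (a :: 'x::infinite ordinal)" "transp_on A le"
  obtains Bs where "cnf_partition le A (cnf a) Bs"
proof (rule cnf_partition_exists_cnf_eval)
  show "has_mot le A (cnf_eval (cnf a))" using assms(1) by (simp only: cnf_eval_cnf)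
qed (rule sorted_cnf, rule assms(2), rule that)

lemma cnf_partition_length: "cnf_partition le A es Bs \<Longrightarrow> length Bs = length es"
  by (auto simp: cnf_partition_def dest: list_all2_lengthD)

lemma cnf_partition_UN: "cnf_partition le A es Bs \<Longrightarrow> (\<Union>p<length es. Bs ! p) = A"
  using cnf_partition_length[of le A es Bs] nth_image[of "length Bs" Bs]
  by (simp add: cnf_partition_def atLeast0LessThan)

lemma cnf_partition_nth_subset: "cnf_partition le A es Bs \<Longrightarrow> p < length es \<Longrightarrow> Bs ! p \<subseteq> A"
  using cnf_partition_UN by fast

lemma cnf_partition_has_mot:
  "cnf_partition le A es Bs \<Longrightarrow> p < length es \<Longrightarrow> has_mot le (Bs ! p) (oexp_omega (es ! p))"
  by (auto simp: cnf_partition_def list_all2_conv_all_nth)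

lemma cnf_partition_nowhere_le:
  "cnf_partition le A es Bs \<Longrightarrow> p < q \<Longrightarrow> q < length es \<Longrightarrow> nowhere_le le (Bs ! q) (Bs ! p)"
  using cnf_partition_length[of le A es Bs] by (simp add: cnf_partition_def sorted_wrt_iff_nth_less)

lemma mot_le_below_less_oexp_omega:
  assumes mot: "has_mot le A (oexp_omega (b :: 'x::infinite ordinal))" and "b \<noteq> 0"
    and "transp_on A le" "x \<in> A"
  obtains c where "c < oexp_omega b" "mot_le le {y \<in> A. le y x} c"
proof -
  obtain c where c: "c < oexp_omega b" "mot_le le (not_above le A x) c"
    using has_rankD(1)[OF mot] \<open>x \<in> A\<close> by (rule rank_leE)
  have "mot_le le {y \<in> A. le x y \<and> le y x} (1 :: 'x ordinal)"
    by (rule rank_le_one) (use assms(3,4) in \<open>auto dest: transp_onD\<close>)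
  with c(2) have "mot_le le (not_above le A x \<union> {y \<in> A. le x y \<and> le y x}) (c + 1)"
    by (rule rank_le_Un)
  then have "mot_le le {y \<in> A. le y x} (c + 1)"
    by (rule rank_le_mono) auto
  moreover have "1 < oexp_omega b"
    using \<open>b \<noteq> 0\<close> oexp_omega_less_iff[of 0 b] by (simp add: ordinal_zero_less_iff)
  ultimately show thesis using that add_less_oexp_omega[OF c(1)] by blast
qed

lemma has_mot_not_below:
  assumes mot: "has_mot le A (oexp_omega (b :: 'x::infinite ordinal))" and "b \<noteq> 0"
    and trans: "transp_on A le" and F: "finite F" "F \<subseteq> A"
  shows "has_mot le (not_below le A F) (oexp_omega b)"
proof -
  obtain v where v: "v \<le> oexp_omega b" "has_mot le (not_below le A F) v"
    using mot residual_subset by (rule has_rank_subset)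
  have "\<exists>c. c < oexp_omega b \<and> mot_le le {y \<in> A. le y x} c" if "x \<in> F" for x
  proof -
    have "x \<in> A" using that F(2) by blast
    with mot \<open>b \<noteq> 0\<close> trans show ?thesis by (rule mot_le_below_less_oexp_omega) blast
  qed
  then have "\<exists>f. \<forall>x\<in>F. f x < oexp_omega b \<and> mot_le le {y \<in> A. le y x} (f x)"
    by (intro bchoice) blast
  then obtain f where f: "\<And>x. x \<in> F \<Longrightarrow> f x < oexp_omega b"
    "\<And>x. x \<in> F \<Longrightarrow> mot_le le {y \<in> A. le y x} (f x)" by blast
  have "mot_le le (not_below le A F \<union> (\<Union>x\<in>F. {y \<in> A. le y x})) (v + (\<Sum>x\<in>F. f x))"
    using has_rankD(1)[OF v(2)] F(1) f(2) by (intro rank_le_Un rank_le_UN)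
  then have "mot_le le A (v + (\<Sum>x\<in>F. f x))"
    by (rule rank_le_mono) auto
  then have "oexp_omega b \<le> v + (\<Sum>x\<in>F. f x)"
    using has_rankD(2)[OF mot] by (rule rank_ge_le_rank_le)
  moreover have "(\<Sum>x\<in>F. f x) < oexp_omega b" using f(1) by (rule sum_less_oexp_omega)
  ultimately have "\<not> v < oexp_omega b" using add_less_oexp_omega by (meson leD)
  then show ?thesis using v by simp
qed

section \<open>The upper bound\<close>

lemma PiE_UN: "Pi\<^sub>E I (\<lambda>k. \<Union>p\<in>N k. B k p) = (\<Union>p\<in>Pi\<^sub>E I N. Pi\<^sub>E I (\<lambda>k. B k (p k)))"
proof (intro set_eqI iffI)
  fix f assume f: "f \<in> Pi\<^sub>E I (\<lambda>k. \<Union>p\<in>N k. B k p)"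
  then have "\<forall>k\<in>I. \<exists>p. p \<in> N k \<and> f k \<in> B k p" by (auto simp: PiE_iff)
  from bchoice[OF this] obtain p where "\<forall>k\<in>I. p k \<in> N k \<and> f k \<in> B k (p k)" by blast
  then have "restrict p I \<in> Pi\<^sub>E I N" "f \<in> Pi\<^sub>E I (\<lambda>k. B k (restrict p I k))"
    using f by (auto simp: PiE_iff)
  then show "f \<in> (\<Union>p\<in>Pi\<^sub>E I N. Pi\<^sub>E I (\<lambda>k. B k (p k)))" by blast
qed (auto simp: PiE_iff)

lemma PiE_update_iff:
  "k \<in> I \<Longrightarrow> f \<in> Pi\<^sub>E I (A(k := X)) \<longleftrightarrow>
    f k \<in> X \<and> (\<forall>i\<in>I - {k}. f i \<in> A i) \<and> f \<in> extensional I"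
  by (force simp: PiE_iff)

lemma PiE_update_UN: "k \<in> I \<Longrightarrow> Pi\<^sub>E I (A(k := \<Union>p\<in>N. B p)) = (\<Union>p\<in>N. Pi\<^sub>E I (A(k := B p)))"
  by (rule set_eqI) (auto simp only: PiE_update_iff UN_iff)

lemma transp_on_fun_upd:
  "transp_on (A k) (le k) \<Longrightarrow> B \<subseteq> A i \<Longrightarrow> transp_on ((A(i := B)) k) (le k)"
  by (auto intro: transp_on_subset)

lemma not_above_PiE:
  "not_above (prod_le I le) (Pi\<^sub>E I A) f = (\<Union>k\<in>I. Pi\<^sub>E I (A(k := not_above (le k) (A k) (f k))))"
  by (fastforce simp: Defs.prod_le_def PiE_iff split: if_splits)

lemma mot_le_not_above_PiE_less:
  fixes s :: "'x::infinite ordinal"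
  assumes "finite I"
    and bounded: "\<And>k. k \<in> I \<Longrightarrow>
      \<exists>r. r < oexp_omega s \<and> mot_le (prod_le I le) (Pi\<^sub>E I (A(k := not_above (le k) (A k) (f k)))) r"
  shows "\<exists>r. r < oexp_omega s \<and> mot_le (prod_le I le) (not_above (prod_le I le) (Pi\<^sub>E I A) f) r"
proof -
  have "\<exists>r. \<forall>k\<in>I. r k < oexp_omega s \<and>
      mot_le (prod_le I le) (Pi\<^sub>E I (A(k := not_above (le k) (A k) (f k)))) (r k)"
    using bounded by (intro bchoice) blast
  then obtain r where r: "\<And>k. k \<in> I \<Longrightarrow> r k < oexp_omega s"
    "\<And>k. k \<in> I \<Longrightarrow> mot_le (prod_le I le) (Pi\<^sub>E I (A(k := not_above (le k) (A k) (f k)))) (r k)"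
    by blast
  have "mot_le (prod_le I le) (not_above (prod_le I le) (Pi\<^sub>E I A) f) (\<Sum>k\<in>I. r k)"
    unfolding not_above_PiE using \<open>finite I\<close> r(2) by (rule rank_le_UN)
  moreover have "(\<Sum>k\<in>I. r k) < oexp_omega s" using r(1) by (rule sum_less_oexp_omega)
  ultimately show ?thesis by blast
qed

lemma mot_le_prod_update_less:
  fixes b :: "nat \<Rightarrow> 'x::infinite ordinal"
  assumes "finite I" "k \<in> I" "transp_on X (le k)" "mot_le (le k) X c" "c < oexp_omega (b k)"
    and block: "\<And>B e. B \<subseteq> X \<Longrightarrow> has_mot (le k) B (oexp_omega e) \<Longrightarrow> e < b k \<Longrightarrow>
      mot_le (prod_le I le) (Pi\<^sub>E I (A(k := B))) (oexp_omega (\<Sum>i\<in>I. (b(k := e)) i))"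
  obtains r where "r < oexp_omega (\<Sum>i\<in>I. b i)" "mot_le (prod_le I le) (Pi\<^sub>E I (A(k := X))) r"
proof -
  obtain d where d: "d \<le> c" "has_mot (le k) X d"
    using assms(4) by (rule has_rank_exists)
  obtain Bs where Bs: "cnf_partition (le k) X (cnf d) Bs"
    using d(2) assms(3) by (rule cnf_partition_exists)
  define s where "s p = (\<Sum>i\<in>I. (b(k := cnf d ! p)) i)" for p
  have "d < oexp_omega (b k)" using d(1) assms(5) by simp
  then have less: "cnf d ! p < b k" if "p < length (cnf d)" for p
    using that by (simp add: less_oexp_omega_iff_cnf_mset cnf_mset_def)
  have "mot_le (prod_le I le) (Pi\<^sub>E I (A(k := Bs ! p))) (oexp_omega (s p))"
    if "p < length (cnf d)" for p
    unfolding s_def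
    using cnf_partition_nth_subset[OF Bs that] cnf_partition_has_mot[OF Bs that] less[OF that]
    by (rule block)
  then have "mot_le (prod_le I le) (\<Union>p<length (cnf d). Pi\<^sub>E I (A(k := Bs ! p)))
      (\<Sum>p<length (cnf d). oexp_omega (s p))"
    by (intro rank_le_UN) auto
  then have "mot_le (prod_le I le) (Pi\<^sub>E I (A(k := X))) (\<Sum>p<length (cnf d). oexp_omega (s p))"
    using cnf_partition_UN[OF Bs] PiE_update_UN[OF assms(2), of A "(!) Bs" "{..<length (cnf d)}"]
    by simp
  moreover have "(\<Sum>p<length (cnf d). oexp_omega (s p)) < oexp_omega (\<Sum>i\<in>I. b i)"
  proof (rule sum_less_oexp_omega)
    fix p assume "p \<in> {..<length (cnf d)}"
    then have "s p < (\<Sum>i\<in>I. b i)"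
      unfolding s_def using assms(1,2) less by (intro sum_fun_upd_less) auto
    then show "oexp_omega (s p) < oexp_omega (\<Sum>i\<in>I. b i)" by simp
  qed
  ultimately show thesis using that by blast
qed

lemma mot_le_prod_indecomposable:
  fixes b :: "nat \<Rightarrow> 'x::infinite ordinal"
  assumes "finite I" "\<And>k. k \<in> I \<Longrightarrow> transp_on (A k) (le k)"
    and "\<And>k. k \<in> I \<Longrightarrow> mot_le (le k) (A k) (oexp_omega (b k))"
  shows "mot_le (prod_le I le) (Pi\<^sub>E I A) (oexp_omega (\<Sum>k\<in>I. b k))"
  using assms
proof (induction "\<Sum>k\<in>I. b k" arbitrary: A b rule: less_induct)
  case less
  show ?case
  proof (rule rank_leI, rule mot_le_not_above_PiE_less[OF less.prems(1)])
    fix f k assume f: "f \<in> Pi\<^sub>E I A" and k: "k \<in> I"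
    let ?X = "not_above (le k) (A k) (f k)"
    have "f k \<in> A k" using f k by auto
    with less.prems(3)[OF k] obtain c where c: "c < oexp_omega (b k)" "mot_le (le k) ?X c"
      by (rule rank_leE)
    have "transp_on ?X (le k)" using less.prems(2)[OF k] residual_subset by (rule transp_on_subset)
    then show "\<exists>r. r < oexp_omega (\<Sum>i\<in>I. b i) \<and> mot_le (prod_le I le) (Pi\<^sub>E I (A(k := ?X))) r"
    proof (rule mot_le_prod_update_less[where b = b and A = A and le = le, OF less.prems(1) k _ c(2,1)])
      fix B e assume B: "B \<subseteq> ?X" "has_mot (le k) B (oexp_omega e)" and "e < b k"
      show "mot_le (prod_le I le) (Pi\<^sub>E I (A(k := B))) (oexp_omega (\<Sum>i\<in>I. (b(k := e)) i))"
      proof (rule less.hyps)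
        show "(\<Sum>i\<in>I. (b(k := e)) i) < (\<Sum>i\<in>I. b i)"
          using less.prems(1) k \<open>e < b k\<close> by (rule sum_fun_upd_less)
        fix i assume i: "i \<in> I"
        show "transp_on ((A(k := B)) i) (le i)"
          using less.prems(2)[OF i] subset_trans[OF B(1) residual_subset] by (rule transp_on_fun_upd)
        show "mot_le (le i) ((A(k := B)) i) (oexp_omega ((b(k := e)) i))"
          using less.prems(3)[OF i] has_rankD(1)[OF B(2)] by simp
      qed (rule less.prems(1))
    qed blast
  qed
qed

definition cnf_terms :: "nat set \<Rightarrow> (nat \<Rightarrow> 'x ordinal) \<Rightarrow> (nat \<Rightarrow> nat) set" where
  "cnf_terms I a = Pi\<^sub>E I (\<lambda>k. {..<length (cnf (a k))})"

definition term_exponent :: "nat set \<Rightarrow> (nat \<Rightarrow> 'x::infinite ordinal) \<Rightarrow> (nat \<Rightarrow> nat) \<Rightarrow> 'x ordinal" where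
  "term_exponent I a p = (\<Sum>k\<in>I. cnf (a k) ! p k)"

lemma finite_cnf_terms: "finite I \<Longrightarrow> finite (cnf_terms I a)"
  by (auto simp: cnf_terms_def intro: finite_PiE)

lemma cnf_termsD: "p \<in> cnf_terms I a \<Longrightarrow> k \<in> I \<Longrightarrow> p k < length (cnf (a k))"
  by (auto simp: cnf_terms_def)

lemma prod_eq_sum_cnf_terms:
  fixes a :: "nat \<Rightarrow> 'x::infinite ordinal"
  assumes "finite I"
  shows "(\<Prod>k\<in>I. a k) = (\<Sum>p\<in>cnf_terms I a. oexp_omega (term_exponent I a p))"
proof -
  have "(\<Prod>k\<in>I. a k) = (\<Prod>k\<in>I. \<Sum>p<length (cnf (a k)). oexp_omega (cnf (a k) ! p))"
    by (simp only: sum_oexp_omega_cnf)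
  then show ?thesis
    using assms by (simp add: prod_sum_PiE cnf_terms_def term_exponent_def oexp_omega_sum)
qed

locale partitioned_product =
  fixes I :: "nat set" and A :: "nat \<Rightarrow> 'b set" and le :: "nat \<Rightarrow> 'b \<Rightarrow> 'b \<Rightarrow> bool"
    and a :: "nat \<Rightarrow> 'x::infinite ordinal" and Bs :: "nat \<Rightarrow> 'b set list"
  assumes finite_I: "finite I"
    and trans: "\<And>k. k \<in> I \<Longrightarrow> transp_on (A k) (le k)"
    and partition: "\<And>k. k \<in> I \<Longrightarrow> cnf_partition (le k) (A k) (cnf (a k)) (Bs k)"
begin

lemma piece_subset: "p \<in> cnf_terms I a \<Longrightarrow> k \<in> I \<Longrightarrow> Bs k ! p k \<subseteq> A k"
  using partition cnf_termsD by (rule cnf_partition_nth_subset)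

lemma has_mot_piece:
  "p \<in> cnf_terms I a \<Longrightarrow> k \<in> I \<Longrightarrow> has_mot (le k) (Bs k ! p k) (oexp_omega (cnf (a k) ! p k))"
  using partition cnf_termsD by (rule cnf_partition_has_mot)

lemma PiE_eq_UN_pieces: "Pi\<^sub>E I A = (\<Union>p\<in>cnf_terms I a. Pi\<^sub>E I (\<lambda>k. Bs k ! p k))"
proof -
  have "Pi\<^sub>E I A = Pi\<^sub>E I (\<lambda>k. \<Union>p<length (cnf (a k)). Bs k ! p)"
    by (rule PiE_cong) (simp add: cnf_partition_UN[OF partition])
  then show ?thesis by (simp add: PiE_UN cnf_terms_def)
qed

lemma mot_le_prod: "mot_le (prod_le I le) (Pi\<^sub>E I A) (\<Prod>k\<in>I. a k)"
  unfolding PiE_eq_UN_pieces prod_eq_sum_cnf_terms[OF finite_I]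
proof (rule rank_le_UN)
  fix p assume p: "p \<in> cnf_terms I a"
  show "mot_le (prod_le I le) (Pi\<^sub>E I (\<lambda>k. Bs k ! p k)) (oexp_omega (term_exponent I a p))"
    unfolding term_exponent_def
  proof (rule mot_le_prod_indecomposable)
    fix k assume k: "k \<in> I"
    show "transp_on (Bs k ! p k) (le k)"
      using trans[OF k] piece_subset[OF p k] by (rule transp_on_subset)
    show "mot_le (le k) (Bs k ! p k) (oexp_omega (cnf (a k) ! p k))"
      using has_mot_piece[OF p k] by (rule has_rankD)
  qed (rule finite_I)
qed (rule finite_cnf_terms[OF finite_I])

end

section \<open>The lower bound\<close>

lemma PiE_not_below_subset:
  assumes "j \<in> I" and escape: "\<And>y. y \<in> F \<Longrightarrow> \<exists>k\<in>I - {j}. \<forall>x\<in>B k. \<not> le k (y k) x"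
  shows "Pi\<^sub>E I (B(j := not_below (le j) C ((\<lambda>y. y j) ` F)))
    \<subseteq> not_comparable (prod_le I le) (Pi\<^sub>E I (B(j := C))) F"
proof
  fix x assume "x \<in> Pi\<^sub>E I (B(j := not_below (le j) C ((\<lambda>y. y j) ` F)))"
  then have x: "x j \<in> not_below (le j) C ((\<lambda>y. y j) ` F)" "\<forall>i\<in>I - {j}. x i \<in> B i" "x \<in> extensional I"
    unfolding PiE_update_iff[OF \<open>j \<in> I\<close>] by blast+
  then have "x \<in> Pi\<^sub>E I (B(j := C))" by (simp add: PiE_update_iff[OF \<open>j \<in> I\<close>] del: fun_upd_apply)
  moreover have "\<not> prod_le I le x y" if "y \<in> F" for y
    using x(1) that \<open>j \<in> I\<close> unfolding Defs.prod_le_def by auto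
  moreover have "\<not> prod_le I le y x" if y: "y \<in> F" for y
  proof -
    obtain k where "k \<in> I - {j}" "\<forall>x\<in>B k. \<not> le k (y k) x" using escape[OF y] by blast
    then show ?thesis using x(2) unfolding Defs.prod_le_def by blast
  qed
  ultimately show "x \<in> not_comparable (prod_le I le) (Pi\<^sub>E I (B(j := C))) F" by simp
qed

text \<open>The blocks are played in the order of the list. A later block is not above the earlier ones in a
  coordinate other than \<^term>\<open>j\<close>, and moves upwards in the indecomposable coordinate \<^term>\<open>j\<close>,
  where a finite set of moves exhausts nothing.\<close>
lemma width_ge_blocks:
  fixes g :: "'p \<Rightarrow> 'x::infinite ordinal" and b :: "'x ordinal"
  assumes "j \<in> I" "transp_on C (le j)" "has_mot (le j) C (oexp_omega b)" "b \<noteq> 0"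
    and "sorted_wrt (\<lambda>q p. g q \<le> g p \<and> (\<exists>k\<in>I - {j}. nowhere_le (le k) (B q k) (B p k))) ps"
    and "\<And>p C'. p \<in> set ps \<Longrightarrow> C' \<subseteq> C \<Longrightarrow> has_mot (le j) C' (oexp_omega b) \<Longrightarrow>
      width_ge (prod_le I le) (Pi\<^sub>E I ((B p)(j := C'))) (oexp_omega (g p))"
  shows "width_ge (prod_le I le) (\<Union>p\<in>set ps. Pi\<^sub>E I ((B p)(j := C))) (\<Sum>p\<leftarrow>ps. oexp_omega (g p))"
  using assms(5,6)
proof (induction ps rule: rev_induct)
  case (snoc p ps)
  let ?X = "Pi\<^sub>E I ((B p)(j := C))" and ?Y = "\<Union>p\<in>set ps. Pi\<^sub>E I ((B p)(j := C))"
  let ?r = "\<Sum>p\<leftarrow>ps. oexp_omega (g p)"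
  have earlier: "g q \<le> g p" "\<exists>k\<in>I - {j}. nowhere_le (le k) (B q k) (B p k)" if "q \<in> set ps" for q
    using snoc.prems(1) that by (auto simp: sorted_wrt_append)
  have "width_ge (prod_le I le) (?X \<union> ?Y) (oadd (oexp_omega (g p)) ?r)"
  proof (rule rank_ge_Un_avoiding)
    show "width_ge (prod_le I le) ?Y ?r"
      by (rule snoc.IH) (use snoc.prems in \<open>auto simp: sorted_wrt_append simp del: fun_upd_apply\<close>)
  next
    fix F assume F: "finite F" "F \<subseteq> ?Y"
    let ?C' = "not_below (le j) C ((\<lambda>y. y j) ` F)"
    have "finite ((\<lambda>y. y j) ` F)" "(\<lambda>y. y j) ` F \<subseteq> C"
      using F \<open>j \<in> I\<close> by (fastforce simp: PiE_iff)+
    with assms(3,4,2) have "has_mot (le j) ?C' (oexp_omega b)"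
      by (rule has_mot_not_below)
    with _ residual_subset have "width_ge (prod_le I le) (Pi\<^sub>E I ((B p)(j := ?C'))) (oexp_omega (g p))"
      by (rule snoc.prems(2)) simp
    moreover have "Pi\<^sub>E I ((B p)(j := ?C')) \<subseteq> not_comparable (prod_le I le) ?X F"
    proof (rule PiE_not_below_subset[OF \<open>j \<in> I\<close>])
      fix y assume "y \<in> F"
      then obtain q where q: "q \<in> set ps" "y \<in> Pi\<^sub>E I ((B q)(j := C))" using F(2) by blast
      obtain k where k: "k \<in> I - {j}" "nowhere_le (le k) (B q k) (B p k)"
        using earlier(2)[OF q(1)] by blast
      then have "y k \<in> B q k" using q(2) PiE_update_iff[OF \<open>j \<in> I\<close>] by metis
      then show "\<exists>k\<in>I - {j}. \<forall>x\<in>B p k. \<not> le k (y k) x" using k unfolding nowhere_le_def by blast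
    qed
    ultimately show "width_ge (prod_le I le) (not_comparable (prod_le I le) ?X F) (oexp_omega (g p))"
      using order.refl by (rule rank_ge_mono)
  qed
  moreover have "oadd (oexp_omega (g p)) ?r = oexp_omega (g p) + ?r"
    using earlier(1) cnf_mset_sum_list_oexp_omega[of "map g ps"]
    by (intro oadd_eq_add) (auto simp: comp_def)
  ultimately show ?case by (simp add: add.commute del: fun_upd_apply)
qed simp

lemma has_mot_oexp_omega_pieces:
  assumes "has_mot le A (oexp_omega (b :: 'x::infinite ordinal))" "transp_on A le" "e < b"
  obtains x Bs where "x \<in> A" "length Bs = n" "sorted_wrt (\<lambda>C B. nowhere_le le B C) Bs"
    "\<forall>B\<in>set Bs. B \<subseteq> not_above le A x \<and> has_mot le B (oexp_omega e)"
proof -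
  have "of_nat n * oexp_omega e < oexp_omega b" using assms(3) by (rule of_nat_times_less_oexp_omega)
  with assms(1) obtain x c where x: "x \<in> A"
    and c: "of_nat n * oexp_omega e \<le> c" "has_mot le (not_above le A x) c"
    by (rule has_rank_residualE)
  have trans: "transp_on (not_above le A x) le"
    using assms(2) residual_subset by (rule transp_on_subset)
  with c(2,1) obtain D
    where D: "down_closed_in le (not_above le A x) D" "has_mot le D (of_nat n * oexp_omega e)"
    by (rule has_mot_down_closed_in)
  then have D_sub: "D \<subseteq> not_above le A x" by (simp add: down_closed_in_def)
  with trans have "transp_on D le" by (rule transp_on_subset)
  with D(2) obtain Bs where Bs: "cnf_partition le D (replicate n e) Bs"
    unfolding cnf_of_nat_times_oexp_omega[symmetric] by (rule cnf_partition_exists)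
  show thesis
  proof (rule that[OF x])
    show "length Bs = n" using cnf_partition_length[OF Bs] by simp
    show "sorted_wrt (\<lambda>C B. nowhere_le le B C) Bs" using Bs by (simp add: cnf_partition_def)
    show "\<forall>B\<in>set Bs. B \<subseteq> not_above le A x \<and> has_mot le B (oexp_omega e)"
      using Bs D_sub unfolding cnf_partition_def
      by (fastforce simp: list_all2_conv_all_nth in_set_conv_nth)
  qed
qed

lemma PiE_piece_subset_residual:
  assumes ij: "i \<in> I" "j \<in> I" "i \<noteq> j" and B: "B \<subseteq> not_above (le i) (A i) (f i)"
  shows "Pi\<^sub>E I (A(i := B, j := not_below (le j) (A j) {f j}))
    \<subseteq> not_comparable (prod_le I le) (Pi\<^sub>E I A) {f}"
proof -
  have "\<exists>k\<in>I - {j}. \<forall>y\<in>(A(i := B)) k. \<not> le k (f k) y"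
    using ij B by (intro bexI[of _ i]) auto
  then have "Pi\<^sub>E I (A(i := B, j := not_below (le j) (A j) {f j}))
      \<subseteq> not_comparable (prod_le I le) (Pi\<^sub>E I (A(i := B, j := A j))) {f}"
    using PiE_not_below_subset[OF ij(2), of "{f}" "A(i := B)" le "A j"] by (simp del: fun_upd_apply)
  also have "\<dots> \<subseteq> not_comparable (prod_le I le) (Pi\<^sub>E I A) {f}"
    using B by (intro residual_mono PiE_mono) auto
  finally show ?thesis .
qed

lemma width_ge_prod_split:
  fixes b d e s :: "'x::infinite ordinal"
  assumes ij: "i \<in> I" "j \<in> I" "i \<noteq> j"
    and trans: "transp_on (A i) (le i)" "transp_on (A j) (le j)"
    and nonempty: "\<And>k. k \<in> I \<Longrightarrow> A k \<noteq> {}"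
    and mot: "has_mot (le i) (A i) (oexp_omega b)" "e < b" "has_mot (le j) (A j) (oexp_omega d)" "d \<noteq> 0"
    and block: "\<And>B C. B \<subseteq> A i \<Longrightarrow> has_mot (le i) B (oexp_omega e) \<Longrightarrow>
      C \<subseteq> A j \<Longrightarrow> has_mot (le j) C (oexp_omega d) \<Longrightarrow>
      width_ge (prod_le I le) (Pi\<^sub>E I (A(i := B, j := C))) (oexp_omega s)"
  obtains f where "f \<in> Pi\<^sub>E I A"
    "width_ge (prod_le I le) (not_comparable (prod_le I le) (Pi\<^sub>E I A) {f}) (of_nat n * oexp_omega s)"
proof -
  obtain x Bs where x: "x \<in> A i"
    and Bs: "length Bs = n" "sorted_wrt (\<lambda>C B. nowhere_le (le i) B C) Bs"
      "\<forall>B\<in>set Bs. B \<subseteq> not_above (le i) (A i) x \<and> has_mot (le i) B (oexp_omega e)"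
    using mot(1) trans(1) mot(2) by (rule has_mot_oexp_omega_pieces[where n = n])
  have "Pi\<^sub>E I A \<noteq> {}" using nonempty by (simp add: PiE_eq_empty_iff)
  then obtain h where h: "h \<in> Pi\<^sub>E I A" by blast
  define f where "f = h(i := x)"
  have f: "f \<in> Pi\<^sub>E I A" "f i = x" "f j \<in> A j"
    using h x ij by (auto simp: f_def PiE_iff extensional_def)
  let ?C = "not_below (le j) (A j) {f j}"
  have C: "has_mot (le j) ?C (oexp_omega d)"
    using mot(3,4) trans(2) by (rule has_mot_not_below) (simp_all add: f(3))
  have "transp_on ?C (le j)" using trans(2) residual_subset by (rule transp_on_subset)
  then have "width_ge (prod_le I le) (\<Union>B\<in>set (rev Bs). Pi\<^sub>E I (A(i := B, j := ?C)))
      (\<Sum>B\<leftarrow>rev Bs. oexp_omega s)"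
  proof (rule width_ge_blocks[where B = "\<lambda>B. A(i := B)" and g = "\<lambda>_. s" and le = le,
        OF ij(2) _ C mot(4)])
    show "sorted_wrt (\<lambda>B' B. s \<le> s \<and>
        (\<exists>k\<in>I - {j}. nowhere_le (le k) ((A(i := B')) k) ((A(i := B)) k))) (rev Bs)"
      unfolding sorted_wrt_rev by (rule sorted_wrt_mono_rel[OF _ Bs(2)]) (use ij in auto)
    fix B C' assume "B \<in> set (rev Bs)" and C': "C' \<subseteq> ?C" "has_mot (le j) C' (oexp_omega d)"
    then have B: "B \<subseteq> not_above (le i) (A i) x" "has_mot (le i) B (oexp_omega e)"
      using Bs(3) by simp_all
    show "width_ge (prod_le I le) (Pi\<^sub>E I (A(i := B, j := C'))) (oexp_omega s)"
      using subset_trans[OF B(1) residual_subset] B(2) subset_trans[OF C'(1) residual_subset] C'(2)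
      by (rule block)
  qed
  moreover have "(\<Union>B\<in>set (rev Bs). Pi\<^sub>E I (A(i := B, j := ?C)))
      \<subseteq> not_comparable (prod_le I le) (Pi\<^sub>E I A) {f}"
    using Bs(3) f(2) by (intro UN_least PiE_piece_subset_residual[OF ij]) auto
  moreover have "of_nat n * oexp_omega s \<le> (\<Sum>B\<leftarrow>rev Bs. oexp_omega s)"
    by (simp add: sum_list_triv Bs(1))
  ultimately have "width_ge (prod_le I le) (not_comparable (prod_le I le) (Pi\<^sub>E I A) {f})
      (of_nat n * oexp_omega s)"
    by (rule rank_ge_mono)
  with f(1) show thesis by (rule that)
qed

text \<open>Two coordinates carry the exponent \<open>1 + c\<close> because the recursion on the exponents must always
  leave a second unbounded coordinate to escape along. For infinite \<open>c\<close> nothing is lost.\<close>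
definition one_plus_on :: "nat set \<Rightarrow> (nat \<Rightarrow> 'x::infinite ordinal) \<Rightarrow> nat \<Rightarrow> 'x ordinal" where
  "one_plus_on J c k = (if k \<in> J then oadd 1 (c k) else c k)"

lemma one_plus_on_nonzero: "j \<in> J \<Longrightarrow> one_plus_on J c j \<noteq> 0"
  using le_oadd_left[of 1 "c j"] by (simp add: one_plus_on_def ordinal_one_le_iff)

lemma one_plus_on_update_same: "d < c i \<Longrightarrow> one_plus_on J (c(i := d)) i < one_plus_on J c i"
  by (simp add: one_plus_on_def)

lemma one_plus_on_update_other: "k \<noteq> i \<Longrightarrow> one_plus_on J (c(i := d)) k = one_plus_on J c k"
  by (simp add: one_plus_on_def)

lemma width_ge_prod_lower_exponent:
  fixes c :: "nat \<Rightarrow> 'x::infinite ordinal" and d s :: "'x ordinal"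
  assumes J: "J \<subseteq> I" "\<And>i. \<exists>j\<in>J. j \<noteq> i" and i: "i \<in> I" "d < c i"
    and trans: "\<And>k. k \<in> I \<Longrightarrow> transp_on (A k) (le k)"
    and mot: "\<And>k. k \<in> I \<Longrightarrow> has_mot (le k) (A k) (oexp_omega (one_plus_on J c k))"
    and lower: "\<And>B. (\<And>k. k \<in> I \<Longrightarrow> transp_on (B k) (le k)) \<Longrightarrow>
      (\<And>k. k \<in> I \<Longrightarrow> has_mot (le k) (B k) (oexp_omega (one_plus_on J (c(i := d)) k))) \<Longrightarrow>
      width_ge (prod_le I le) (Pi\<^sub>E I B) (oexp_omega s)"
  obtains f where "f \<in> Pi\<^sub>E I A"
    "width_ge (prod_le I le) (not_comparable (prod_le I le) (Pi\<^sub>E I A) {f}) (of_nat n * oexp_omega s)"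
proof -
  obtain j where j: "j \<in> J" "i \<noteq> j" using J(2) by blast
  then have "j \<in> I" using J(1) by blast
  have nonempty: "A k \<noteq> {}" if "k \<in> I" for k
    using has_rankD(2)[OF mot[OF that]] by (rule rank_ge_nonempty) simp
  have block: "width_ge (prod_le I le) (Pi\<^sub>E I (A(i := B, j := C))) (oexp_omega s)"
    if B: "B \<subseteq> A i" "has_mot (le i) B (oexp_omega (one_plus_on J (c(i := d)) i))"
      and C: "C \<subseteq> A j" "has_mot (le j) C (oexp_omega (one_plus_on J c j))" for B C
  proof (rule lower)
    fix k assume k: "k \<in> I"
    have "transp_on ((A(i := B)) k) (le k)" using trans[OF k] B(1) by (rule transp_on_fun_upd)
    then show "transp_on ((A(i := B, j := C)) k) (le k)"
      by (rule transp_on_fun_upd) (use C(1) j(2) in simp)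
    show "has_mot (le k) ((A(i := B, j := C)) k) (oexp_omega (one_plus_on J (c(i := d)) k))"
      using B(2) C(2) mot[OF k] j(2) by (cases "k = i") (auto simp: one_plus_on_update_other)
  qed
  have "one_plus_on J (c(i := d)) i < one_plus_on J c i" using i(2) by (rule one_plus_on_update_same)
  with i(1) \<open>j \<in> I\<close> j(2) trans[OF i(1)] trans[OF \<open>j \<in> I\<close>] nonempty mot[OF i(1)]
  obtain f where "f \<in> Pi\<^sub>E I A"
    "width_ge (prod_le I le) (not_comparable (prod_le I le) (Pi\<^sub>E I A) {f}) (of_nat n * oexp_omega s)"
    using mot[OF \<open>j \<in> I\<close>] one_plus_on_nonzero[of j J c, OF j(1)] block
    by (rule width_ge_prod_split)
  then show thesis by (rule that)
qed

lemma width_ge_prod_indecomposable: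
  fixes c :: "nat \<Rightarrow> 'x::infinite ordinal"
  assumes fin: "finite I" and J: "J \<subseteq> I" "\<And>i. \<exists>j\<in>J. j \<noteq> i"
    and "\<And>k. k \<in> I \<Longrightarrow> transp_on (A k) (le k)"
    and "\<And>k. k \<in> I \<Longrightarrow> has_mot (le k) (A k) (oexp_omega (one_plus_on J c k))"
  shows "width_ge (prod_le I le) (Pi\<^sub>E I A) (oexp_omega (\<Sum>k\<in>I. c k))"
  using assms(4,5)
proof (induction "\<Sum>k\<in>I. c k" arbitrary: A c rule: less_induct)
  case less
  show ?case
  proof (rule rank_geI)
    fix d assume "d < oexp_omega (\<Sum>k\<in>I. c k)"
    then consider (zero) "d = 0" | (pos) t n where "t < (\<Sum>k\<in>I. c k)" "d < of_nat n * oexp_omega t"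
      unfolding less_oexp_omega_iff_of_nat_times by blast
    then show "\<exists>f\<in>Pi\<^sub>E I A. width_ge (prod_le I le) (not_comparable (prod_le I le) (Pi\<^sub>E I A) {f}) d"
    proof cases
      case zero
      have "A k \<noteq> {}" if "k \<in> I" for k
        using has_rankD(2)[OF less.prems(2)[OF that]] by (rule rank_ge_nonempty) simp
      then have "Pi\<^sub>E I A \<noteq> {}" by (simp add: PiE_eq_empty_iff)
      then show ?thesis unfolding zero by auto
    next
      case (pos t n)
      obtain i e where i: "i \<in> I" "e < c i" "t \<le> (\<Sum>k\<in>I. (c(i := e)) k)"
        using fin pos(1) by (rule less_sum_ordinalE)
      let ?s = "\<Sum>k\<in>I. (c(i := e)) k"
      have "?s < (\<Sum>k\<in>I. c k)" using fin i(1,2) by (rule sum_fun_upd_less)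
      from J i(1,2) less.prems less.hyps[OF this] obtain f where f: "f \<in> Pi\<^sub>E I A"
        "width_ge (prod_le I le) (not_comparable (prod_le I le) (Pi\<^sub>E I A) {f}) (of_nat n * oexp_omega ?s)"
        by (rule width_ge_prod_lower_exponent)
      have "d \<le> of_nat n * oexp_omega ?s"
        using pos(2) of_nat_times_oexp_omega_mono[OF i(3)] by (meson less_imp_le order_trans)
      with f(2) order.refl
      have "width_ge (prod_le I le) (not_comparable (prod_le I le) (Pi\<^sub>E I A) {f}) d"
        by (rule rank_ge_mono)
      then show ?thesis using f(1) by blast
    qed
  qed
qed

text \<open>Terms with equal exponents are listed by decreasing index sum, so that a later term never
  dominates an earlier one in all coordinates.\<close>
lemma cnf_terms_sorted_list_exists:
  fixes a :: "nat \<Rightarrow> 'x::infinite ordinal"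
  assumes "finite I"
  obtains ps where "set ps = cnf_terms I a" "distinct ps"
    "sorted_wrt (\<lambda>q p. term_exponent I a q \<le> term_exponent I a p \<and> (\<exists>k\<in>I. p k < q k)) ps"
proof -
  define key where "key p = (term_exponent I a p, - int (\<Sum>k\<in>I. p k))" for p
  obtain xs where xs: "set xs = cnf_terms I a" "distinct xs"
    using finite_distinct_list[OF finite_cnf_terms[OF assms]] by blast
  define ps where "ps = sort_key key xs"
  have ps: "set ps = cnf_terms I a" "distinct ps" using xs by (simp_all add: ps_def)
  have step: "term_exponent I a q \<le> term_exponent I a p \<and> (\<exists>k\<in>I. p k < q k)"
    if key: "key q \<le> key p" and qp: "q \<in> cnf_terms I a" "p \<in> cnf_terms I a" "q \<noteq> p" for q p
  proof
    show exponents: "term_exponent I a q \<le> term_exponent I a p"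
      using key by (auto simp: key_def less_eq_prod_def)
    show "\<exists>k\<in>I. p k < q k"
    proof (rule ccontr)
      assume "\<not> (\<exists>k\<in>I. p k < q k)"
      then have below: "q k \<le> p k" if "k \<in> I" for k using that by (auto simp: not_less)
      have "cnf (a k) ! p k \<le> cnf (a k) ! q k" if "k \<in> I" for k
        using sorted_cnf[of "a k"] below[OF that] cnf_termsD[OF qp(2) that]
        by (cases "q k = p k") (auto simp: sorted_wrt_iff_nth_less)
      then have "term_exponent I a p \<le> term_exponent I a q"
        unfolding term_exponent_def by (rule sum_mono)
      then have "(\<Sum>k\<in>I. p k) \<le> (\<Sum>k\<in>I. q k)"
        using exponents key by (auto simp: key_def less_eq_prod_def simp del: of_nat_sum)
      moreover have "\<exists>k\<in>I. q k < p k"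
        using qp below unfolding cnf_terms_def by (metis PiE_ext order_le_less)
      then have "(\<Sum>k\<in>I. q k) < (\<Sum>k\<in>I. p k)"
        using assms below by (intro sum_strict_mono_ex1) auto
      ultimately show False by simp
    qed
  qed
  have "sorted (map key ps)" by (simp add: ps_def)
  then have sorted: "sorted_wrt (\<lambda>q p. key q \<le> key p) ps" by (simp add: sorted_map)
  have "sorted_wrt (\<lambda>q p. term_exponent I a q \<le> term_exponent I a p \<and> (\<exists>k\<in>I. p k < q k)) ps"
    unfolding sorted_wrt_iff_nth_less
  proof (intro allI impI)
    fix m n assume "m < n" "n < length ps"
    then show "term_exponent I a (ps ! m) \<le> term_exponent I a (ps ! n) \<and> (\<exists>k\<in>I. (ps ! n) k < (ps ! m) k)"
      using sorted ps by (intro step) (auto simp: sorted_wrt_iff_nth_less nth_eq_iff_index_eq)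
  qed
  with ps show thesis by (rule that)
qed

context partitioned_product
begin

lemma pieces_sorted_list_exists:
  assumes "\<And>p. p \<in> cnf_terms I a \<Longrightarrow> p i = 0"
  obtains ps where "set ps = cnf_terms I a" "distinct ps"
    "sorted_wrt (\<lambda>q p. term_exponent I a q \<le> term_exponent I a p \<and>
      (\<exists>k\<in>I - {i}. nowhere_le (le k) (Bs k ! q k) (Bs k ! p k))) ps"
proof -
  obtain ps where ps: "set ps = cnf_terms I a" "distinct ps"
    "sorted_wrt (\<lambda>q p. term_exponent I a q \<le> term_exponent I a p \<and> (\<exists>k\<in>I. p k < q k)) ps"
    using finite_I by (rule cnf_terms_sorted_list_exists)
  have "sorted_wrt (\<lambda>q p. term_exponent I a q \<le> term_exponent I a p \<and>
      (\<exists>k\<in>I - {i}. nowhere_le (le k) (Bs k ! q k) (Bs k ! p k))) ps"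
  proof (rule sorted_wrt_mono_rel[OF _ ps(3)])
    fix q p assume qp: "q \<in> set ps" "p \<in> set ps"
      and before: "term_exponent I a q \<le> term_exponent I a p \<and> (\<exists>k\<in>I. p k < q k)"
    then obtain k where k: "k \<in> I" "p k < q k" by blast
    then have "k \<noteq> i" using assms[of p] assms[of q] qp ps(1) by auto
    moreover have "q k < length (cnf (a k))" using cnf_termsD k(1) qp(1) ps(1) by blast
    with partition[OF k(1)] k(2) have "nowhere_le (le k) (Bs k ! q k) (Bs k ! p k)"
      by (rule cnf_partition_nowhere_le)
    ultimately show "term_exponent I a q \<le> term_exponent I a p \<and>
        (\<exists>k\<in>I - {i}. nowhere_le (le k) (Bs k ! q k) (Bs k ! p k))"
      using before k(1) by blast
  qed
  with ps(1,2) show thesis by (rule that)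
qed

lemma width_ge_piece:
  assumes J: "J \<subseteq> I" "\<And>i. \<exists>j\<in>J. j \<noteq> i" "\<And>j. j \<in> J \<Longrightarrow> all_cnf_exponents_infinite (a j)"
    and p: "p \<in> cnf_terms I a" and C: "C \<subseteq> A i" "has_mot (le i) C (oexp_omega (cnf (a i) ! p i))"
  shows "width_ge (prod_le I le) (Pi\<^sub>E I ((\<lambda>k. Bs k ! p k)(i := C))) (oexp_omega (term_exponent I a p))"
  unfolding term_exponent_def
proof (rule width_ge_prod_indecomposable[OF finite_I J(1,2)])
  fix k assume k: "k \<in> I"
  have "((\<lambda>k. Bs k ! p k)(i := C)) k \<subseteq> A k" using piece_subset[OF p k] C(1) by simp
  with trans[OF k] show "transp_on (((\<lambda>k. Bs k ! p k)(i := C)) k) (le k)" by (rule transp_on_subset)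
  have "one_plus_on J (\<lambda>k. cnf (a k) ! p k) k = cnf (a k) ! p k"
    using J(3)[of k] cnf_termsD[OF p k]
    by (auto simp: one_plus_on_def all_cnf_exponents_infinite_def intro: one_oadd_infinite)
  then show "has_mot (le k) (((\<lambda>k. Bs k ! p k)(i := C)) k)
      (oexp_omega (one_plus_on J (\<lambda>k. cnf (a k) ! p k) k))"
    using has_mot_piece[OF p k] C(2) by simp
qed

lemma width_ge_prod:
  assumes i: "i \<in> I" "a i = oexp_omega b" "b \<noteq> 0" "has_mot (le i) (A i) (a i)"
    and J: "J \<subseteq> I" "\<And>i. \<exists>j\<in>J. j \<noteq> i" "\<And>j. j \<in> J \<Longrightarrow> all_cnf_exponents_infinite (a j)"
  shows "width_ge (prod_le I le) (Pi\<^sub>E I A) (\<Prod>k\<in>I. a k)"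
proof -
  let ?B = "\<lambda>p k. Bs k ! p k"
  have at_i: "p i = 0" if "p \<in> cnf_terms I a" for p
    using cnf_termsD[OF that i(1)] i(2) by simp
  obtain ps where ps: "set ps = cnf_terms I a" "distinct ps"
    "sorted_wrt (\<lambda>q p. term_exponent I a q \<le> term_exponent I a p \<and>
      (\<exists>k\<in>I - {i}. nowhere_le (le k) (?B q k) (?B p k))) ps"
    using at_i by (rule pieces_sorted_list_exists)
  have "width_ge (prod_le I le) (\<Union>p\<in>set ps. Pi\<^sub>E I ((?B p)(i := A i)))
      (\<Sum>p\<leftarrow>ps. oexp_omega (term_exponent I a p))"
  proof (rule width_ge_blocks[where B = ?B and g = "term_exponent I a" and le = le,
        OF i(1) trans[OF i(1)] i(4)[unfolded i(2)] i(3) ps(3)])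
    fix p C assume p: "p \<in> set ps" and C: "C \<subseteq> A i" "has_mot (le i) C (oexp_omega b)"
    then have "p \<in> cnf_terms I a" "cnf (a i) ! p i = b" using ps(1) i(2) at_i[of p] by simp_all
    with J C show "width_ge (prod_le I le) (Pi\<^sub>E I ((?B p)(i := C))) (oexp_omega (term_exponent I a p))"
      by (intro width_ge_piece) simp_all
  qed
  moreover have "(\<Union>p\<in>set ps. Pi\<^sub>E I ((?B p)(i := A i))) \<subseteq> Pi\<^sub>E I A"
    unfolding ps(1) using piece_subset by (intro UN_least PiE_mono) simp
  moreover have "(\<Prod>k\<in>I. a k) \<le> (\<Sum>p\<leftarrow>ps. oexp_omega (term_exponent I a p))"
    by (simp add: prod_eq_sum_cnf_terms[OF finite_I] sum_list_distinct_conv_sum_set[OF ps(2)] ps(1))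
  ultimately show ?thesis by (rule rank_ge_mono)
qed

end

section \<open>Forests of sequences\<close>

definition related_seqs :: "('b \<Rightarrow> 'b \<Rightarrow> bool) \<Rightarrow> 'b set \<Rightarrow> 'b list set" where
  "related_seqs Q A = {xs. xs \<noteq> [] \<and> set xs \<subseteq> A \<and> sorted_wrt Q xs}"

lemma bad_seqs_eq_related_seqs: "bad_seqs A le = related_seqs (\<lambda>x y. \<not> le x y) A"
  by (auto simp: bad_seqs_def related_seqs_def sorted_wrt_iff_nth_less)

lemma antichain_seqs_eq_related_seqs: "antichain_seqs A le = related_seqs (incomp le) A"
proof -
  have "(\<forall>i j. i < length xs \<and> j < length xs \<and> i \<noteq> j \<longrightarrow> \<not> le (xs ! i) (xs ! j))
      \<longleftrightarrow> sorted_wrt (incomp le) xs" for xs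
    unfolding sorted_wrt_iff_nth_less by (metis linorder_neqE_nat order_less_trans order_less_irrefl)
  then show ?thesis by (auto simp: antichain_seqs_def related_seqs_def)
qed

lemma snoc_in_related_seqs_iff:
  "s @ [x] \<in> related_seqs Q A \<longleftrightarrow> (s = [] \<or> s \<in> related_seqs Q A) \<and> x \<in> residual Q A (set s)"
  by (auto simp: related_seqs_def sorted_wrt_append)

lemma related_seqs_prefix:
  "t \<in> related_seqs Q A \<Longrightarrow> prefix s t \<Longrightarrow> s \<noteq> [] \<Longrightarrow> s \<in> related_seqs Q A"
  by (auto simp: related_seqs_def prefix_def sorted_wrt_append)

definition has_infinite_seq :: "('b \<Rightarrow> 'b \<Rightarrow> bool) \<Rightarrow> 'b set \<Rightarrow> bool" where
  "has_infinite_seq Q A \<longleftrightarrow> (\<exists>f :: nat \<Rightarrow> 'b. (\<forall>i. f i \<in> A) \<and> (\<forall>i j. i < j \<longrightarrow> Q (f i) (f j)))"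

lemma wf_related_seqs:
  assumes "\<not> has_infinite_seq Q A"
  shows "wf {(t, s). t \<in> related_seqs Q A \<and> s \<in> related_seqs Q A \<and> strict_prefix s t}"
proof (rule ccontr)
  assume "\<not> ?thesis"
  then obtain s where s: "\<And>i. s (Suc i) \<in> related_seqs Q A" "\<And>i. strict_prefix (s i) (s (Suc i))"
    unfolding wf_iff_no_infinite_down_chain by auto
  have length_ge: "i \<le> length (s i)" for i
  proof (induction i)
    case (Suc i)
    then show ?case using prefix_length_less[OF s(2), of i] by simp
  qed simp
  have prefix_mono: "prefix (s i) (s j)" if "i \<le> j" for i j
    using that
  proof (induction rule: dec_induct)
    case (step j)
    then show ?case using s(2)[of j] prefix_order.trans prefix_order.less_imp_le by blast
  qed simp
  let ?f = "\<lambda>i. s (Suc i) ! i"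
  have stable: "?f i = s (Suc j) ! i" if "i \<le> j" for i j
    using prefix_mono[of "Suc i" "Suc j"] length_ge[of "Suc i"] that
    by (auto simp: prefix_def nth_append)
  have "?f i \<in> A" for i
    using s(1)[of i] length_ge[of "Suc i"] nth_mem[of i "s (Suc i)"] by (auto simp: related_seqs_def)
  moreover have "Q (?f i) (?f j)" if "i < j" for i j
    using s(1)[of j] length_ge[of "Suc j"] stable[of i j] that
    by (auto simp: related_seqs_def sorted_wrt_iff_nth_less)
  ultimately have "has_infinite_seq Q A" unfolding has_infinite_seq_def by (intro exI[of _ ?f]) simp
  then show False using assms by blast
qed

lemma rank_le_imp_not_has_infinite_seq:
  assumes "rank_le Q A a"
  shows "\<not> has_infinite_seq Q A"
  using assms
proof (induction a arbitrary: A rule: less_induct)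
  case (less a)
  show ?case
  proof
    assume "has_infinite_seq Q A"
    then obtain f :: "nat \<Rightarrow> 'a" where f: "\<forall>i. f i \<in> A" "\<forall>i j. i < j \<longrightarrow> Q (f i) (f j)"
      unfolding has_infinite_seq_def by blast
    then have "f 0 \<in> A" by simp
    obtain b where b: "b < a" "rank_le Q (residual Q A {f 0}) b"
      using less.prems \<open>f 0 \<in> A\<close> by (rule rank_leE)
    have "has_infinite_seq Q (residual Q A {f 0})"
      unfolding has_infinite_seq_def using f by (intro exI[of _ "\<lambda>i. f (Suc i)"]) simp
    with less.IH[OF b] show False by (rule notE)
  qed
qed

lemma small_list_image:
  fixes h :: "'b list \<Rightarrow> 'x ordinal"
  assumes "|UNIV :: 'b list set| \<le>o |UNIV :: 'x set|"
  shows "small {h t | t. P t}"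
proof -
  have "{h t | t. P t} = h ` Collect P" by auto
  then have "|{h t | t. P t}| \<le>o |Collect P|" by (simp add: card_of_image)
  also have "|Collect P| \<le>o |UNIV :: 'b list set|" by (rule card_of_mono1) simp
  also note assms
  finally show ?thesis by (simp add: small_def)
qed

lemma less_forest_rank_iff:
  fixes F :: "'b list set"
  assumes "|UNIV :: 'b list set| \<le>o |UNIV :: 'x::infinite set|"
  shows "b < (forest_rank F :: 'x ordinal) \<longleftrightarrow> (\<exists>t\<in>F. b \<le> node_rank F t)"
  unfolding forest_rank_def less_osup_iff[OF small_list_image[OF assms]] by auto

lemma less_node_rank_iff:
  fixes F :: "'b list set"
  assumes card: "|UNIV :: 'b list set| \<le>o |UNIV :: 'x::infinite set|"
    and wf: "wf {(t, s). t \<in> F \<and> s \<in> F \<and> strict_prefix s t}" and s: "s \<in> F"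
  shows "b < (node_rank F s :: 'x ordinal) \<longleftrightarrow> (\<exists>t\<in>F. strict_prefix s t \<and> b \<le> node_rank F t)"
proof -
  let ?R = "{(t, s). t \<in> F \<and> s \<in> F \<and> strict_prefix s t}"
  let ?rk = "node_rank F :: 'b list \<Rightarrow> 'x ordinal"
  have "?rk s = osup {osucc (cut ?rk ?R s t) | t. t \<in> F \<and> strict_prefix s t}"
    unfolding node_rank_def by (subst wfrec[OF wf]) (rule refl)
  also have "{osucc (cut ?rk ?R s t) | t. t \<in> F \<and> strict_prefix s t}
      = {osucc (?rk t) | t. t \<in> F \<and> strict_prefix s t}"
    using s by (intro Collect_cong) (auto simp: cut_def)
  finally show ?thesis
    by (simp only: less_osup_iff[OF small_list_image[OF card]]) auto
qed

context
  fixes Q :: "'b \<Rightarrow> 'b \<Rightarrow> bool" and A :: "'b set" and rk :: "'b list \<Rightarrow> 'x::infinite ordinal"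
  assumes card: "|UNIV :: 'b list set| \<le>o |UNIV :: 'x set|"
    and no_infinite_seq: "\<not> has_infinite_seq Q A"
  defines "rk \<equiv> node_rank (related_seqs Q A)"
begin

lemmas less_node_rank_related_seqs_iff =
  less_node_rank_iff[OF card wf_related_seqs[OF no_infinite_seq], folded rk_def]

lemma node_rank_antimono:
  assumes "t \<in> related_seqs Q A" "prefix s t" "s \<noteq> []"
  shows "rk t \<le> rk s"
proof (cases "s = t")
  case False
  then have "strict_prefix s t" using assms(2) by (simp add: strict_prefix_def)
  then have "rk t < rk s"
    using less_node_rank_related_seqs_iff[OF related_seqs_prefix[OF assms]] assms(1) by blast
  then show ?thesis by simp
qed simp

lemma has_rank_residual_if_children:
  assumes s: "s = [] \<or> s \<in> related_seqs Q A"
    and children: "\<And>x. s @ [x] \<in> related_seqs Q A \<Longrightarrow>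
      has_rank Q (residual Q A (set (s @ [x]))) (rk (s @ [x]))"
    and r: "\<And>b. b < r \<longleftrightarrow> (\<exists>t\<in>related_seqs Q A. strict_prefix s t \<and> b \<le> rk t)"
  shows "has_rank Q (residual Q A (set s)) r"
  unfolding has_rank_def
proof
  have child: "has_rank Q (residual Q (residual Q A (set s)) {x}) (rk (s @ [x]))"
    if "s @ [x] \<in> related_seqs Q A" for x
    using children[OF that] by (simp add: residual_residual)
  show "rank_le Q (residual Q A (set s)) r"
  proof (rule rank_leI)
    fix x assume "x \<in> residual Q A (set s)"
    then have x: "s @ [x] \<in> related_seqs Q A" using s by (simp add: snoc_in_related_seqs_iff)
    moreover have "strict_prefix s (s @ [x])" by (simp add: strict_prefix_def)
    ultimately have "rk (s @ [x]) < r" unfolding r by blast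
    then show "\<exists>b<r. rank_le Q (residual Q (residual Q A (set s)) {x}) b"
      using has_rankD(1)[OF child[OF x]] by blast
  qed
  show "rank_ge Q (residual Q A (set s)) r"
  proof (rule rank_geI)
    fix b assume "b < r"
    then obtain t where t: "t \<in> related_seqs Q A" "strict_prefix s t" "b \<le> rk t" unfolding r by blast
    then obtain x ys where "t = s @ x # ys" by (elim strict_prefixE')
    then have x: "prefix (s @ [x]) t" by simp
    then have sx: "s @ [x] \<in> related_seqs Q A" using related_seqs_prefix[OF t(1)] by blast
    have "b \<le> rk (s @ [x])" using t(3) node_rank_antimono[OF t(1) x] by simp
    with has_rankD(2)[OF child[OF sx]] order.refl
    have "rank_ge Q (residual Q (residual Q A (set s)) {x}) b" by (rule rank_ge_mono)
    then show "\<exists>x\<in>residual Q A (set s). rank_ge Q (residual Q (residual Q A (set s)) {x}) b"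
      using sx unfolding snoc_in_related_seqs_iff by blast
  qed
qed

lemma has_rank_node_rank:
  "s \<in> related_seqs Q A \<Longrightarrow> has_rank Q (residual Q A (set s)) (rk s)"
proof (induction s rule: wf_induct_rule[OF wf_related_seqs[OF no_infinite_seq], case_names less])
  case (less s)
  show ?case
  proof (rule has_rank_residual_if_children)
    fix x assume "s @ [x] \<in> related_seqs Q A"
    then show "has_rank Q (residual Q A (set (s @ [x]))) (rk (s @ [x]))"
      using less.IH[of "s @ [x]"] less.prems by (simp add: strict_prefix_def)
  qed (simp_all add: less.prems less_node_rank_related_seqs_iff)
qed

lemma has_rank_forest_rank: "has_rank Q A (forest_rank (related_seqs Q A) :: 'x ordinal)"
proof -
  have "has_rank Q (residual Q A (set [])) (forest_rank (related_seqs Q A) :: 'x ordinal)"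
  proof (rule has_rank_residual_if_children)
    fix b :: "'x ordinal"
    have "strict_prefix [] t" if "t \<in> related_seqs Q A" for t
      using that by (cases t) (simp_all add: related_seqs_def)
    then show "b < forest_rank (related_seqs Q A) \<longleftrightarrow>
        (\<exists>t\<in>related_seqs Q A. strict_prefix [] t \<and> b \<le> rk t)"
      unfolding less_forest_rank_iff[OF card] rk_def by blast
  qed (simp, rule has_rank_node_rank)
  then show ?thesis by simp
qed

end

section \<open>The width of a product\<close>

lemma has_mot_wqo_mot:
  fixes A :: "'b set"
  assumes "wqo_on A le" "|UNIV :: 'b list set| \<le>o |UNIV :: 'x::infinite set|"
  shows "has_mot le A (wqo_mot A le :: 'x ordinal)"
proof -
  have "\<not> has_infinite_seq (\<lambda>x y. \<not> le x y) A"
    unfolding has_infinite_seq_def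
  proof
    assume "\<exists>f :: nat \<Rightarrow> 'b. (\<forall>i. f i \<in> A) \<and> (\<forall>i j. i < j \<longrightarrow> \<not> le (f i) (f j))"
    then obtain f :: "nat \<Rightarrow> 'b" where f: "\<forall>i. f i \<in> A" "\<And>i j. i < j \<Longrightarrow> \<not> le (f i) (f j)" by blast
    from assms(1) f(1) have "\<exists>i j. i < j \<and> le (f i) (f j)" by (simp add: wqo_on_def)
    then show False using f(2) by blast
  qed
  with assms(2) show ?thesis
    unfolding wqo_mot_def bad_seqs_eq_related_seqs by (rule has_rank_forest_rank)
qed

lemma has_rank_wqo_width:
  fixes A :: "'b set"
  assumes "mot_le le A a" "|UNIV :: 'b list set| \<le>o |UNIV :: 'x::infinite set|"
  shows "has_rank (incomp le) A (wqo_width A le :: 'x ordinal)"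
proof -
  have "rank_le (incomp le) A a" using assms(1) by (rule rank_le_mono) auto
  then have "\<not> has_infinite_seq (incomp le) A" by (rule rank_le_imp_not_has_infinite_seq)
  with assms(2) show ?thesis
    unfolding wqo_width_def antichain_seqs_eq_related_seqs by (rule has_rank_forest_rank)
qed

theorem wqo_width_prod_eq_prod_wqo_mot:
  fixes A :: "nat \<Rightarrow> 'b set" and le :: "nat \<Rightarrow> 'b \<Rightarrow> 'b \<Rightarrow> bool"
    and a :: "nat \<Rightarrow> 'x::infinite ordinal"
  defines "a \<equiv> \<lambda>k. wqo_mot (A k) (le k)"
  assumes card: "|UNIV :: (nat \<Rightarrow> 'b) list set| \<le>o |UNIV :: 'x set|"
    and fin: "finite I" and wqo: "\<And>k. k \<in> I \<Longrightarrow> wqo_on (A k) (le k)"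
    and i: "i \<in> I" "infinite_indecomposable (a i)"
    and J: "J \<subseteq> I" "\<And>i. \<exists>j\<in>J. j \<noteq> i" "\<And>j. j \<in> J \<Longrightarrow> all_cnf_exponents_infinite (a j)"
  shows "wqo_width (Pi\<^sub>E I A) (prod_le I le) = (\<Prod>k\<in>I. a k)"
proof -
  have "|UNIV :: 'b list set| \<le>o |UNIV :: (nat \<Rightarrow> 'b) list set|"
    by (rule card_of_ordLeqI[of "map (\<lambda>x k. x)"])
      (auto intro: inj_onI simp: inj_map_eq_map inj_def fun_eq_iff)
  then have "|UNIV :: 'b list set| \<le>o |UNIV :: 'x set|" using card by (rule ordLeq_transitive)
  with wqo have mot: "has_mot (le k) (A k) (a k)" if "k \<in> I" for k
    unfolding a_def using that by (intro has_mot_wqo_mot)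
  have trans: "transp_on (A k) (le k)" if "k \<in> I" for k
    using wqo[OF that] unfolding wqo_on_def qo_on_def by (intro transp_onI) blast
  have "\<exists>Bs. cnf_partition (le k) (A k) (cnf (a k)) Bs" if "k \<in> I" for k
    using mot[OF that] trans[OF that] by (rule cnf_partition_exists) blast
  then obtain Bs where Bs: "\<And>k. k \<in> I \<Longrightarrow> cnf_partition (le k) (A k) (cnf (a k)) (Bs k)"
    by metis
  interpret partitioned_product I A le a Bs
    using fin trans Bs by unfold_locales
  obtain b where b: "b \<noteq> 0" "a i = oexp_omega b"
    using i(2) unfolding infinite_indecomposable_def
    by (auto simp: ordinal_one_le_iff simp flip: one_ordinal_def)
  have "rank_le (incomp (prod_le I le)) (Pi\<^sub>E I A) (\<Prod>k\<in>I. a k)"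
    using mot_le_prod by (rule rank_le_mono) auto
  moreover have "width_ge (prod_le I le) (Pi\<^sub>E I A) (\<Prod>k\<in>I. a k)"
    using i(1) b(2,1) mot[OF i(1)] J by (rule width_ge_prod)
  ultimately have "has_rank (incomp (prod_le I le)) (Pi\<^sub>E I A) (\<Prod>k\<in>I. a k)"
    by (simp add: has_rank_def)
  with has_rank_wqo_width[OF mot_le_prod card] show ?thesis by (rule has_rank_unique)
qed

lemma fold_natural_prod:
  fixes f :: "nat \<Rightarrow> 'x::infinite ordinal"
  assumes "1 \<le> n"
  shows "fold (\<lambda>k acc. natural_prod acc (f k)) [2..<Suc n] (f 1) = (\<Prod>k\<in>{1..n}. f k)"
  using assms
proof (induction n rule: dec_induct)
  case (step n)
  then have "[2..<Suc (Suc n)] = [2..<Suc n] @ [Suc n]" by simp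
  then show ?case using step by (simp add: times_ordinal_def[symmetric] mult.commute)
qed simp

theorem mainTheorem15:
  fixes n :: nat and A :: "nat \<Rightarrow> 'a set" and le :: "nat \<Rightarrow> 'a \<Rightarrow> 'a \<Rightarrow> bool"
  assumes wqo: "\<forall>k\<in>{1..n}. wqo_on (A k) (le k)"
    and indec: "\<exists>i\<in>{1..n}. infinite_indecomposable (wqo_mot (A i) (le i) :: 'a big_ordinal)"
    and expinf: "\<exists>j1\<in>{1..n}. \<exists>j2\<in>{1..n}. j1 \<noteq> j2 \<and>
        all_cnf_exponents_infinite (wqo_mot (A j1) (le j1) :: 'a big_ordinal) \<and>
        all_cnf_exponents_infinite (wqo_mot (A j2) (le j2) :: 'a big_ordinal)"
  shows "(wqo_width (Pi\<^sub>E {1..n} A) (prod_le {1..n} le) :: 'a big_ordinal) =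
         fold (\<lambda>k acc. natural_prod acc (wqo_mot (A k) (le k))) [2..<Suc n] (wqo_mot (A 1) (le 1))"
proof -
  let ?a = "\<lambda>k. wqo_mot (A k) (le k) :: 'a big_ordinal"
  have card: "|UNIV :: (nat \<Rightarrow> 'a) list set| \<le>o |UNIV :: ((nat \<Rightarrow> 'a) list \<times> nat) set|"
    by (rule card_of_ordLeqI[of "\<lambda>xs. (xs, 0)"]) (auto simp: inj_on_def)
  obtain i where i: "i \<in> {1..n}" "infinite_indecomposable (?a i)" using indec by blast
  obtain j1 j2 where j: "j1 \<in> {1..n}" "j2 \<in> {1..n}" "j1 \<noteq> j2"
    "all_cnf_exponents_infinite (?a j1)" "all_cnf_exponents_infinite (?a j2)"
    using expinf by blast
  have "wqo_width (Pi\<^sub>E {1..n} A) (prod_le {1..n} le) = (\<Prod>k\<in>{1..n}. ?a k)"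
  proof (rule wqo_width_prod_eq_prod_wqo_mot[where J = "{j1, j2}" and A = A and le = le, OF card _ _ i])
    show "\<exists>j\<in>{j1, j2}. j \<noteq> i'" for i' using j(3) by auto
  qed (use wqo j in auto)
  also have "\<dots> = fold (\<lambda>k acc. natural_prod acc (?a k)) [2..<Suc n] (?a 1)"
    using i(1) by (intro fold_natural_prod[symmetric]) simp
  finally show ?thesis .
qed

end
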